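(* Let $d\ge 1$, let $L\subset\mathbb{R}^d$ be a lattice with fundamental domain $\Omega$ and dual lattice $L^{\perp}$. Let $0<\alpha\le 1$ and $1<p\le 2$. If $f\in \mathrm{Lip}_{\Omega}(\alpha;p)$, then $\widehat f\in \ell^{\gamma}(L^{\perp})$ for every $\gamma$ with $$\frac{p}{p+\frac{\alpha}{d}p-1}<\gamma\le\infty .$$
   Context: A lattice is $L=A\mathbb{Z}^d$ with $A$ an invertible real $d\times d$ matrix; its dual lattice is $L^{\perp}:=(A^{T})^{-1}\mathbb{Z}^d$. A fundamental domain of $L$ is a measurable set $\Omega\subseteq\mathbb{R}^d$ such that $\Omega+L=\mathbb{R}^d$ as a direct sum (every $x\in\mathbb{R}^d$ is uniquely $\omega+\ell$ with $\omega\in\Omega$, $\ell\in L$). $L^p(\Omega)$ is taken with respect to the normalised measure $\mathrm{d}x/|\Omega|$; functions on $\Omega$ are extended $L$-periodically to $\mathbb{R}^d$, which gives meaning to $f(\cdot+h)$. The Fourier transform is $\widehat f(\kappa)=\frac{1}{|\Omega|}\int_{\Omega}f(x)e^{-2\pi i\kappa\cdot x}\,\mathrm{d}x$ for $\kappa\in L^{\perp}$. For $0<\alpha\le1$, $1<p\le\infty$, the additive Hölder-Lipschitz space is $$\mathrm{Lip}_{\Omega}(\alpha;p):=\{f\in L^p(\Omega): \|f(\cdot+h)-f(\cdot)\|_{L^p(\Omega)}=O(|h|^{\alpha})\text{ as }h\to0\},$$ where $|h|$ is the Euclidean norm and $O$ means: there are a constant $C>0$ and a neighbourhood of $h=0$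 on which the left side is at most $C|h|^\alpha$. *)

theory Defs
  imports "HOL-Analysis.Analysis" "HOL-Library.Landau_Symbols"
begin

definition lattice_of :: "real^'d^'d \<Rightarrow> (real^'d) set" where
  "lattice_of A = (\<lambda>z. A *v z) ` {z. \<forall>i. z $ i \<in> \<int>}"

definition dual_lattice_of :: "real^'d^'d \<Rightarrow> (real^'d) set" where
  "dual_lattice_of A = lattice_of (matrix_inv (transpose A))"

definition fundamental_domain :: "(real^'d) set \<Rightarrow> (real^'d) set \<Rightarrow> bool" where
  "fundamental_domain L \<Omega> \<longleftrightarrow>
     \<Omega> \<in> sets lebesgue \<and>
     (\<forall>x. \<exists>!q. q \<in> \<Omega> \<times> L \<and> x = fst q + snd q)"

text \<open>A function on \<open>\<Omega>\<close> is a total function of which only the values on \<open>\<Omega>\<close> are used.\<close>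

definition periodic_ext ::
    "(real^'d) set \<Rightarrow> (real^'d) set \<Rightarrow> (real^'d \<Rightarrow> complex) \<Rightarrow> real^'d \<Rightarrow> complex" where
  "periodic_ext L \<Omega> f x = f (THE \<omega>. \<omega> \<in> \<Omega> \<and> (\<exists>l\<in>L. x = \<omega> + l))"

text \<open>The normalised Lebesgue measure on \<open>\<Omega>\<close>. Its underlying space is \<open>\<Omega>\<close> itself, so
  measurability of \<open>f\<close> with respect to it does not constrain \<open>f\<close> outside \<open>\<Omega>\<close>.\<close>

definition normalised_measure :: "(real^'d) set \<Rightarrow> (real^'d) measure" where
  "normalised_measure \<Omega> = uniform_measure (lebesgue_on \<Omega>) \<Omega>"

definition Lp_space :: "'a measure \<Rightarrow> real \<Rightarrow> ('a \<Rightarrow> complex) set" where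
  "Lp_space M p = {f \<in> borel_measurable M. integrable M (\<lambda>x. norm (f x) powr p)}"

text \<open>This is the \<open>L\<^sup>p\<close> norm for elements of \<^const>\<open>Lp_space\<close> only: for other functions the
  Bochner integral may be 0 by convention.\<close>

definition Lp_norm :: "'a measure \<Rightarrow> real \<Rightarrow> ('a \<Rightarrow> complex) \<Rightarrow> real" where
  "Lp_norm M p f = (LINT x|M. norm (f x) powr p) powr (1 / p)"

text \<open>If \<open>\<Omega>\<close> is a fundamental domain of \<open>L\<close> and \<open>f \<in> L\<^sup>p(\<Omega>)\<close>, the differences below lie in
  \<open>L\<^sup>p(\<Omega>)\<close> for every \<open>h\<close>, since the measure on \<open>\<Omega>\<close> is invariant under translation modulo \<open>L\<close>;
  so \<^const>\<open>Lp_norm\<close> is applied to elements of \<^const>\<open>Lp_space\<close>. The filter is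
  \<^term>\<open>nhds 0\<close>, which includes \<open>h = 0\<close>; there both sides vanish.\<close>

definition Lip_space ::
    "(real^'d) set \<Rightarrow> (real^'d) set \<Rightarrow> real \<Rightarrow> real \<Rightarrow> (real^'d \<Rightarrow> complex) set" where
  "Lip_space L \<Omega> \<alpha> p =
     {f \<in> Lp_space (normalised_measure \<Omega>) p.
        (\<lambda>h. Lp_norm (normalised_measure \<Omega>) p
               (\<lambda>x. periodic_ext L \<Omega> f (x + h) - periodic_ext L \<Omega> f x))
          \<in> O[nhds 0](\<lambda>h. norm h powr \<alpha>)}"

definition fourier_coeff :: "(real^'d) set \<Rightarrow> (real^'d \<Rightarrow> complex) \<Rightarrow> real^'d \<Rightarrow> complex" where
  "fourier_coeff \<Omega> f \<kappa> =
     1 / complex_of_real (measure lebesgue \<Omega>) *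
     (LINT x|lebesgue_on \<Omega>. f x * exp (- 2 * complex_of_real pi * \<i> * complex_of_real (\<kappa> \<bullet> x)))"

text \<open>Meant for \<open>0 < \<gamma> \<le> \<infinity>\<close>; values \<open>\<gamma> < 1\<close> are allowed.\<close>

definition ell_space :: "ereal \<Rightarrow> 'a set \<Rightarrow> ('a \<Rightarrow> complex) set" where
  "ell_space \<gamma> S =
     {a. if \<gamma> = \<infinity> then bounded (a ` S)
         else (\<lambda>k. norm (a k) powr real_of_ereal \<gamma>) summable_on S}"

end

theory Submission
  imports Defs
begin

text \<open>The Fourier coefficients of \<open>f(\<cdot> + h) - f\<close> are those of \<open>f\<close> times a factor that is bounded
  away from 0 when \<open>\<kappa> \<bullet> h\<close> lies in \<open>[1/4, 1/2]\<close> up to sign. On a dyadic shell of frequencies of size \<open>R\<close> one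
  takes \<open>h\<close> of size \<open>1/R\<close> along the columns of \<open>A\<close>, and the Hausdorff-Young inequality bounds the
  coefficients there. Its weak-type form (a count of the coefficients above a level \<open>t\<close>) suffices,
  because the range of \<open>\<gamma>\<close> is open. With \<open>1/p + 1/q = 1\<close> the number of coefficients of modulus at
  least \<open>t\<close> is at most of order \<open>R\<^sup>d + \<Sum>\<^sub>k ((2\<^sup>k R) powr (-\<alpha>) / t) powr q\<close>, where the first term
  counts all frequencies up to \<open>R\<close>; optimising \<open>R\<close> puts the coefficients in
  weak \<open>\<ell>\<close> with the critical exponent, hence in every larger \<open>\<ell>\<^sup>\<gamma>\<close>.\<close>

subsection \<open>A weak-type Hausdorff-Young inequality\<close>

text \<open>Pointwise \<open>norm (g x)\<close> is at most \<open>1 + norm (g x) powr p\<close>, and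
  constants are integrable for a finite measure.\<close>

lemma integrable_of_integrable_powr:
  fixes g :: "'a \<Rightarrow> complex"
  assumes "finite_measure M" "p \<ge> 1" "g \<in> borel_measurable M"
    and "integrable M (\<lambda>x. norm (g x) powr p)"
  shows "integrable M g"
proof -
  interpret finite_measure M by fact
  have "norm (g x) \<le> norm (1 + norm (g x) powr p)" for x
  proof (cases "norm (g x) \<le> 1")
    case False
    then have "norm (g x) powr 1 \<le> norm (g x) powr p"
      using assms(2) by (intro powr_mono) auto
    with False show ?thesis by simp
  qed (simp add: add_increasing2)
  moreover have "integrable M (\<lambda>x. 1 + norm (g x) powr p)"
    using assms(4) by simp
  ultimately show ?thesis
    using assms(3) by (intro Bochner_Integration.integrable_bound[of M "\<lambda>x. 1 + norm (g x) powr p" g]) auto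
qed

lemma norm_sum_unimodular_le:
  fixes e :: "'k \<Rightarrow> 'a \<Rightarrow> complex"
  assumes "\<And>k. k \<in> S \<Longrightarrow> norm (s k) \<le> 1" "\<And>k. k \<in> S \<Longrightarrow> norm (e k x) \<le> 1"
  shows "norm (\<Sum>k\<in>S. s k * e k x) \<le> real (card S)"
proof -
  have "norm (\<Sum>k\<in>S. s k * e k x) \<le> (\<Sum>k\<in>S. 1::real)"
    by (rule sum_norm_le) (metis assms mult_le_one norm_ge_zero norm_mult)
  then show ?thesis by simp
qed

text \<open>By duality: with unimodular \<open>s k\<close> aligning the coefficients, the polynomial
  \<open>P = (\<Sum>k\<in>S. s k * e k)\<close> satisfies \<open>t * card S \<le> \<bar>\<integral> g P\<bar>\<close>, while \<open>\<bar>P\<bar> \<le> card S\<close> and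
  \<open>\<integral> \<bar>P\<bar>\<^sup>2 = card S\<close> control the \<open>L\<^sup>q\<close> norm of \<open>P\<close>.\<close>

lemma weak_Hausdorff_Young:
  fixes e :: "'k \<Rightarrow> 'a \<Rightarrow> complex" and g :: "'a \<Rightarrow> complex"
  assumes M: "finite_measure M" and fin: "finite S"
    and p: "1 < p" "p \<le> 2" and q: "1 / p + 1 / q = 1"
    and e_meas [measurable]: "\<And>k. e k \<in> borel_measurable M"
    and e_le: "\<And>k x. norm (e k x) \<le> 1"
    and orth: "\<And>k l. k \<in> S \<Longrightarrow> l \<in> S \<Longrightarrow>
        (LINT x|M. e k x * cnj (e l x)) = (if k = l then 1 else 0)"
    and g_meas [measurable]: "g \<in> borel_measurable M"
    and g_int: "integrable M (\<lambda>x. norm (g x) powr p)"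
    and B: "B > 0" "(LINT x|M. norm (g x) powr p) \<le> B powr p"
    and lam: "t > 0" "\<And>k. k \<in> S \<Longrightarrow> t \<le> norm (LINT x|M. g x * e k x)"
  shows "real (card S) \<le> (B / t) powr q"
proof (cases "S = {}")
  case True
  then show ?thesis by simp
next
  case False
  interpret finite_measure M by fact
  define N where "N = real (card S)"
  have N: "N \<ge> 1" using False fin by (simp add: N_def Suc_leI card_gt_0_iff)
  \<comment> \<open>This is where \<open>p \<le> 2\<close> enters: it makes the exponent
    \<open>q - 2\<close> nonnegative when the sup bound on \<open>P\<close> is raised to it.\<close>
  have q2: "q \<ge> 2"
  proof -
    have "1 / q \<le> 1 / 2" using q p frac_le[of 1 1 p 2] by linarith
    moreover have "1 / q > 0" using q p by (smt (verit) divide_less_eq_1_pos)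
    ultimately show ?thesis by (simp add: field_simps)
  qed
  have qp: "q - 1 = q / p" using q p q2 by (simp add: field_simps)
  define c where "c k = (LINT x|M. g x * e k x)" for k
  define s where "s k = cnj (sgn (c k))" for k
  define P where "P x = (\<Sum>k\<in>S. s k * e k x)" for x
  have [measurable]: "P \<in> borel_measurable M" unfolding P_def by measurable
  have c0: "c k \<noteq> 0" if "k \<in> S" for k using lam that by (force simp: c_def)
  have s1: "norm (s k) = 1" if "k \<in> S" for k
    using c0[OF that] by (simp add: s_def norm_sgn)
  have sc: "s k * c k = norm (c k)" for k
    by (simp add: s_def sgn_eq complex_norm_square[symmetric] mult.commute
        power2_eq_square divide_simps flip: of_real_mult)
  have ss: "s k * cnj (s k) = 1" if "k \<in> S" for k
    using s1[OF that] by (simp add: complex_norm_square[symmetric])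
  have P_le: "norm (P x) \<le> N" for x
    unfolding P_def N_def by (rule norm_sum_unimodular_le) (use s1 e_le in auto)
  have g_integrable: "integrable M g"
    using integrable_of_integrable_powr[OF M _ g_meas g_int] p by simp
  have ge_int: "integrable M (\<lambda>x. g x * e k x)" for k
    by (rule Bochner_Integration.integrable_bound[OF g_integrable])
      (use e_le[of k] in \<open>auto simp: norm_mult intro!: AE_I2 mult_left_le\<close>)
  have gP_int: "integrable M (\<lambda>x. norm (g x * P x))"
  proof (rule Bochner_Integration.integrable_bound)
    show "integrable M (\<lambda>x. N * norm (g x))" using g_integrable by simp
    show "AE x in M. norm (norm (g x * P x)) \<le> norm (N * norm (g x))"
      using P_le N by (auto simp: norm_mult abs_mult mult.commute[of N] intro!: mult_left_mono)
  qed measurable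
  have ee_int: "integrable M (\<lambda>x. s k * cnj (s l) * (e k x * cnj (e l x)))" if "k \<in> S" "l \<in> S" for k l
  proof (rule integrable_const_bound[where B = 1])
    have "norm (e k x) * norm (e l x) \<le> 1" for x by (simp add: e_le mult_le_one)
    then show "AE x in M. norm (s k * cnj (s l) * (e k x * cnj (e l x))) \<le> 1"
      using s1 that by (simp add: norm_mult)
  qed (auto intro!: borel_measurable_times measurable_compose[OF e_meas borel_measurable_continuous_onI[of cnj]] continuous_intros)
  have int_PP: "(LINT x|M. P x * cnj (P x)) = of_real N"
  proof -
    have "P x * cnj (P x) = (\<Sum>k\<in>S. \<Sum>l\<in>S. s k * cnj (s l) * (e k x * cnj (e l x)))" for x
      by (simp add: P_def sum_product mult_ac)
    then have "(LINT x|M. P x * cnj (P x))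
        = (\<Sum>k\<in>S. \<Sum>l\<in>S. LINT x|M. s k * cnj (s l) * (e k x * cnj (e l x)))"
      using ee_int by (simp add: Bochner_Integration.integral_sum Bochner_Integration.integrable_sum)
    also have "\<dots> = (\<Sum>k\<in>S. \<Sum>l\<in>S. if k = l then 1 else 0)"
      using orth ss by (intro sum.cong refl) auto
    also have "\<dots> = of_real N" using fin by (simp add: N_def)
    finally show ?thesis .
  qed
  have P_bdd: "integrable M (\<lambda>x. norm (P x) powr r)" if "r > 0" for r
    by (rule integrable_const_bound[where B = "N powr r"]) (use P_le that in \<open>auto intro!: powr_mono2\<close>)
  have int_P2: "(LINT x|M. norm (P x) powr 2) = N"
  proof -
    have "complex_of_real (LINT x|M. norm (P x) powr 2) = (LINT x|M. P x * cnj (P x))"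
      by (simp add: complex_norm_square[symmetric] flip: integral_complex_of_real of_real_power)
    then show ?thesis using int_PP by (metis of_real_eq_iff)
  qed
  have int_Pq: "(LINT x|M. norm (P x) powr q) \<le> N powr (q - 1)"
  proof -
    \<comment> \<open>Interpolation between the sup norm and the square mean: \<open>q - 2\<close>
      factors are bounded by \<open>N\<close>, the other two are left for orthogonality.\<close>
    have "norm (P x) powr q \<le> N powr (q - 2) * norm (P x) powr 2" for x
    proof -
      have "norm (P x) powr q = norm (P x) powr (q - 2) * norm (P x) powr 2"
        using powr_add[of "norm (P x)" "q - 2" 2] by simp
      also have "\<dots> \<le> N powr (q - 2) * norm (P x) powr 2"
        using P_le q2 by (intro mult_right_mono powr_mono2) auto
      finally show ?thesis .
    qed
    then have "(LINT x|M. norm (P x) powr q) \<le> (LINT x|M. N powr (q - 2) * norm (P x) powr 2)"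
      using P_bdd[of q] P_bdd[of 2] q2 by (intro integral_mono) auto
    also have "\<dots> = N powr (q - 2) * N powr 1" using int_P2 N by simp
    also have "\<dots> = N powr (q - 1)" using powr_add[of N "q - 2" 1] by simp
    finally show ?thesis .
  qed
  \<comment> \<open>\<open>D\<close> bounds the q-norm of \<open>P\<close>, because
    \<open>D powr q = N powr (q - 1)\<close>. With \<open>g\<close> scaled by \<open>B\<close> and
    \<open>P\<close> by \<open>D\<close>, Young's inequality integrates to
    \<open>1 / p + 1 / q = 1\<close>, which is Hoelder's inequality for this pair.\<close>
  define D where "D = N powr (1 / p)"
  have D: "D > 0" using N by (simp add: D_def)
  have Dq: "D powr q = N powr (q - 1)" by (simp add: D_def powr_powr qp)
  have "norm (g x * P x) / (B * D) \<le> norm (g x) powr p / (p * B powr p) + norm (P x) powr q / (q * D powr q)" for x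
    using Youngs_inequality[of p q "norm (g x) / B" "norm (P x) / D"] p q q2 B D
    by (simp add: norm_mult powr_divide mult.commute)
  then have "(LINT x|M. norm (g x * P x) / (B * D))
      \<le> (LINT x|M. norm (g x) powr p / (p * B powr p) + norm (P x) powr q / (q * D powr q))"
    using gP_int g_int P_bdd[of q] q2 by (intro integral_mono) auto
  also have "\<dots> = (LINT x|M. norm (g x) powr p) / (p * B powr p)
      + (LINT x|M. norm (P x) powr q) / (q * D powr q)"
    using g_int P_bdd[of q] q2 by simp
  also have "\<dots> \<le> B powr p / (p * B powr p) + D powr q / (q * D powr q)"
    using B(2) int_Pq Dq p q2 by (intro add_mono divide_right_mono) auto
  also have "\<dots> = 1" using q B D by simp
  finally have upper: "(LINT x|M. norm (g x * P x)) \<le> B * D"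
    using B D by (simp add: field_simps)
  have "N * t = (\<Sum>k\<in>S. t)" by (simp add: N_def)
  also have "\<dots> \<le> (\<Sum>k\<in>S. norm (c k))" using lam by (intro sum_mono) (auto simp: c_def)
  also have "\<dots> = norm (\<Sum>k\<in>S. s k * c k)"
    by (simp add: sc sum_nonneg flip: of_real_sum)
  also have "(\<Sum>k\<in>S. s k * c k) = (LINT x|M. (\<Sum>k\<in>S. s k * (g x * e k x)))"
    using ge_int by (simp add: Bochner_Integration.integral_sum c_def)
  also have "\<dots> = (LINT x|M. g x * P x)"
    by (simp add: P_def sum_distrib_left mult_ac)
  also have "norm \<dots> \<le> (LINT x|M. norm (g x * P x))" by (rule integral_norm_bound)
  also note upper
  finally have "N * t \<le> B * D" .
  \<comment> \<open>Cancelling \<open>D = N powr (1 / p)\<close> from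
    \<open>N * t \<le> B * D\<close> leaves a bound on \<open>N powr (1 / q)\<close>.\<close>
  moreover have "N = D * N powr (1 / q)"
    unfolding D_def by (simp add: q N flip: powr_add) (use N in simp)
  ultimately have "D * (N powr (1 / q)) * t \<le> B * D" by simp
  then have "N powr (1 / q) \<le> B / t"
    using D lam by (simp add: field_simps)
  then have "(N powr (1 / q)) powr q \<le> (B / t) powr q"
    using q2 by (intro powr_mono2) auto
  then show ?thesis using N q2 by (simp add: powr_powr N_def)
qed

section \<open>Dyadic decomposition and summability from a weak-type bound\<close>

lemma dyadic_level:
  fixes C t :: real
  assumes "0 < t" "t \<le> C"
  obtains j :: nat where "C / 2 ^ Suc j \<le> t" "t \<le> C / 2 ^ j"
proof -
  obtain n :: nat where "C / t < 2 ^ n" using real_arch_pow[of 2 "C / t"] by auto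
  then have n: "C / 2 ^ n < t" using assms by (simp add: field_simps)
  \<comment> \<open>Since \<open>t \<le> C\<close>, the least such exponent is not 0, and its
    predecessor is the required level.\<close>
  define m where "m = (LEAST n::nat. C / 2 ^ n < t)"
  have m: "C / 2 ^ m < t" unfolding m_def by (rule LeastI[of _ n]) (rule n)
  then obtain j where j: "m = Suc j" using assms by (cases m) auto
  then have "\<not> C / 2 ^ j < t" using not_less_Least[of j "\<lambda>n. C / 2 ^ n < t"] by (simp add: m_def)
  then show ?thesis using that[of j] m j by simp
qed

text \<open>For \<open>0 < t \<le> C\<close> some \<open>j\<close> has \<open>C / 2 ^ (j + 1) \<le> t \<le> C / 2 ^ j\<close>; hence \<open>a k powr \<gamma>\<close> is at
  most the sum over \<open>j\<close> of \<open>(C / 2 ^ j) powr \<gamma>\<close> restricted to \<open>a k \<ge> C / 2 ^ (j + 1)\<close>.\<close>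

lemma summable_on_powr_of_weak_bound:
  fixes a :: "'k \<Rightarrow> real"
  assumes a: "\<And>k. k \<in> A \<Longrightarrow> 0 \<le> a k" "\<And>k. k \<in> A \<Longrightarrow> a k \<le> C" and C: "C > 0" and K: "K \<ge> 0"
    and count: "\<And>t F. 0 < t \<Longrightarrow> t \<le> C \<Longrightarrow> finite F \<Longrightarrow> F \<subseteq> A \<Longrightarrow> (\<And>k. k \<in> F \<Longrightarrow> t \<le> a k) \<Longrightarrow>
        real (card F) \<le> K * t powr (- \<gamma>\<^sub>0)"
    and \<gamma>: "\<gamma>\<^sub>0 < \<gamma>" "0 < \<gamma>"
  shows "(\<lambda>k. a k powr \<gamma>) summable_on A"
proof (rule nonneg_bdd_above_summable_on)
  \<comment> \<open>\<open>r\<close> is the ratio of the bounds for consecutive levels;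
    \<open>\<gamma>\<^sub>0 < \<gamma>\<close> makes it less than 1. The factor
    \<open>2 powr \<gamma>\<^sub>0\<close> in \<open>Z\<close> arises because level \<open>j\<close>
    is counted at the threshold \<open>C / 2 ^ Suc j\<close>.\<close>
  define r where "r = (2::real) powr (\<gamma>\<^sub>0 - \<gamma>)"
  have r: "0 < r" "r < 1" using \<gamma> powr_less_mono[of "\<gamma>\<^sub>0 - \<gamma>" 0 2] by (auto simp: r_def)
  define Z where "Z = K * C powr (\<gamma> - \<gamma>\<^sub>0) * 2 powr \<gamma>\<^sub>0"
  have Z: "Z \<ge> 0" using K by (simp add: Z_def)
  have level: "real (card F) * (C / 2 ^ j) powr \<gamma> \<le> Z * r ^ j"
    if "finite F" "F \<subseteq> A" "\<And>k. k \<in> F \<Longrightarrow> C / 2 ^ Suc j \<le> a k" for F j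
  proof -
    have "real (card F) \<le> K * (C / 2 ^ Suc j) powr (- \<gamma>\<^sub>0)"
    proof (rule count)
      have "C * 1 \<le> C * 2 ^ Suc j" using C by (intro mult_left_mono one_le_power) auto
      then show "C / 2 ^ Suc j \<le> C" by (simp add: field_simps)
    qed (use that C in auto)
    then have "real (card F) * (C / 2 ^ j) powr \<gamma> \<le> K * (C / 2 ^ Suc j) powr (- \<gamma>\<^sub>0) * (C / 2 ^ j) powr \<gamma>"
      by (intro mult_right_mono) auto
    also have "\<dots> = Z * r ^ j"
    proof -
      have half: "C / 2 ^ i = C * 2 powr (- real i)" for i
        by (simp add: powr_minus powr_realpow divide_inverse)
      have 1: "(C / 2 ^ j) powr \<gamma> = C powr \<gamma> * 2 powr (- (real j * \<gamma>))"
        using C half[of j] by (simp add: powr_mult powr_powr)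
      have 2: "(C / 2 ^ Suc j) powr (- \<gamma>\<^sub>0) = C powr (- \<gamma>\<^sub>0) * 2 powr (real (Suc j) * \<gamma>\<^sub>0)"
        using C half[of "Suc j"] by (simp add: powr_mult powr_powr del: power_Suc of_nat_Suc)
      have 3: "r ^ j = 2 powr (- (real j * (\<gamma> - \<gamma>\<^sub>0)))"
        using r powr_realpow[of r j] by (simp add: r_def powr_powr algebra_simps)
      have 4: "(2::real) powr (real (Suc j) * \<gamma>\<^sub>0) * 2 powr (- (real j * \<gamma>)) = 2 powr \<gamma>\<^sub>0 * 2 powr (- (real j * (\<gamma> - \<gamma>\<^sub>0)))"
        by (simp add: algebra_simps flip: powr_add)
      have 5: "C powr (- \<gamma>\<^sub>0) * C powr \<gamma> = C powr (\<gamma> - \<gamma>\<^sub>0)" by (simp flip: powr_add)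
      have swap: "K * (x * y) * (z * w) = K * (x * z) * (y * w)" for x y z w :: real by simp
      show ?thesis unfolding 1 2 3 Z_def by (subst swap, subst 4, subst 5, rule mult.assoc[symmetric])
    qed
    finally show ?thesis .
  qed
  have bound: "(\<Sum>k\<in>F. a k powr \<gamma>) \<le> Z * (1 / (1 - r))" if F: "F \<subseteq> A" "finite F" for F
  proof -
    have "\<exists>j. C / 2 ^ Suc j \<le> a k \<and> a k \<le> C / 2 ^ j" if "k \<in> F" "a k > 0" for k
      using dyadic_level[of "a k" C] a(2)[of k] that F(1) by (metis subsetD)
    then obtain j where j: "\<And>k. k \<in> F \<Longrightarrow> a k > 0 \<Longrightarrow> C / 2 ^ Suc (j k) \<le> a k \<and> a k \<le> C / 2 ^ j k"
      by metis
    \<comment> \<open>A cutoff beyond all levels that occur in \<open>F\<close>;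
      \<open>insert 0\<close> covers empty \<open>F\<close>. The final bound depends on neither
      \<open>J\<close> nor \<open>F\<close>.\<close>
    define J where "J = Suc (Max (insert 0 (j ` F)))"
    have jJ: "j k < J" if "k \<in> F" for k using F that by (simp add: J_def le_imp_less_Suc)
    define W where "W i = {k \<in> F. C / 2 ^ Suc i \<le> a k}" for i
    have "(\<Sum>k\<in>F. a k powr \<gamma>) \<le> (\<Sum>k\<in>F. \<Sum>i<J. if k \<in> W i then (C / 2 ^ i) powr \<gamma> else 0)"
    proof (rule sum_mono)
      fix k assume k: "k \<in> F"
      show "a k powr \<gamma> \<le> (\<Sum>i<J. if k \<in> W i then (C / 2 ^ i) powr \<gamma> else 0)"
      \<comment> \<open>A zero value lies on no dyadic level, but then
        \<open>0 powr \<gamma> = 0\<close>. Otherwise the term of level \<open>j k\<close> alone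
        suffices, so the sets \<open>W i\<close> may overlap.\<close>
      proof (cases "a k = 0")
        case True
        then show ?thesis using \<gamma> by (simp add: sum_nonneg)
      next
        case False
        then have "a k > 0" using a(1)[of k] k F by force
        note jk = j[OF k this]
        have "a k powr \<gamma> \<le> (C / 2 ^ j k) powr \<gamma>" using jk \<open>a k > 0\<close> \<gamma> by (intro powr_mono2) auto
        also have "\<dots> = (if k \<in> W (j k) then (C / 2 ^ j k) powr \<gamma> else 0)" using jk k by (simp add: W_def)
        also have "\<dots> \<le> (\<Sum>i<J. if k \<in> W i then (C / 2 ^ i) powr \<gamma> else 0)"
          using jJ[OF k] by (intro member_le_sum) auto
        finally show ?thesis .
      qed
    qed
    also have "\<dots> = (\<Sum>i<J. \<Sum>k\<in>F. if k \<in> W i then (C / 2 ^ i) powr \<gamma> else 0)"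
      by (rule sum.swap)
    also have "\<dots> = (\<Sum>i<J. real (card (W i)) * (C / 2 ^ i) powr \<gamma>)"
    proof (intro sum.cong refl)
      fix i
      have "F \<inter> W i = W i" by (auto simp: W_def)
      then show "(\<Sum>k\<in>F. if k \<in> W i then (C / 2 ^ i) powr \<gamma> else 0) = real (card (W i)) * (C / 2 ^ i) powr \<gamma>"
        using sum.inter_restrict[OF F(2), of "\<lambda>_. (C / 2 ^ i) powr \<gamma>" "W i"] by simp
    qed
    also have "\<dots> \<le> (\<Sum>i<J. Z * r ^ i)"
      using F by (intro sum_mono level) (auto simp: W_def)
    also have "\<dots> = Z * (\<Sum>i<J. r ^ i)" by (simp add: sum_distrib_left)
    also have "\<dots> \<le> Z * (1 / (1 - r))"
      using Z r by (intro mult_left_mono) (auto simp: sum_gp_strict divide_right_mono)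
    finally show ?thesis .
  qed
  then show "bdd_above (sum (\<lambda>k. a k powr \<gamma>) ` {F. F \<subseteq> A \<and> finite F})"
    by (intro bdd_aboveI2[where M = "Z * (1 / (1 - r))"]) auto
qed auto

subsection \<open>Lattices and their duals\<close>

lemma emeasure_lebesgue_translation:
  "emeasure lebesgue ((+) a ` S) = emeasure lebesgue (S :: 'a::euclidean_space set)"
  using emeasure_lebesgue_affine[of 1 a S] by (simp add: add.commute[of a])

lemma vimage_translation_eq_image: "(+) a -` S = (+) (- a) ` (S :: 'a::group_add set)"
proof -
  have "x \<in> (+) (- a) ` S" if "a + x \<in> S" for x
    using that by (intro image_eqI[where x = "a + x"]) (auto simp: add.assoc[symmetric])
  then show ?thesis by (auto simp: add.assoc[symmetric])
qed

lemma vimage_translation_lebesgue: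
  fixes S :: "'a::euclidean_space set"
  assumes "S \<in> sets lebesgue"
  shows "(+) a -` S \<in> sets lebesgue"
  using lebesgue_sets_translation[OF assms, of "- a"] by (simp only: vimage_translation_eq_image)

lemma emeasure_lebesgue_vimage_translation:
  "emeasure lebesgue ((+) a -` S) = emeasure lebesgue (S :: 'a::euclidean_space set)"
  by (simp only: vimage_translation_eq_image emeasure_lebesgue_translation)

text \<open>\<open>matrix_inv\<close> is a choice among two-sided inverses, and invertibility says
  that there is one to choose.\<close>

lemma
  fixes A :: "real^'n^'n"
  assumes "invertible A"
  shows matrix_inv_right: "A ** matrix_inv A = mat 1" and matrix_inv_left: "matrix_inv A ** A = mat 1"
proof -
  have "\<exists>A'. A ** A' = mat 1 \<and> A' ** A = mat 1" using assms by (simp add: invertible_def)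
  then have "A ** matrix_inv A = mat 1 \<and> matrix_inv A ** A = mat 1"
    unfolding matrix_inv_def by (rule someI_ex)
  then show "A ** matrix_inv A = mat 1" "matrix_inv A ** A = mat 1" by auto
qed

lemma zero_in_lattice: "0 \<in> lattice_of A"
  unfolding lattice_of_def by (rule image_eqI[where x = 0]) auto

lemma lattice_diff: "x \<in> lattice_of A \<Longrightarrow> y \<in> lattice_of A \<Longrightarrow> x - y \<in> lattice_of A"
  unfolding lattice_of_def by (auto simp: matrix_vector_mult_diff_distrib[symmetric] intro!: imageI)

lemma lattice_minus: "x \<in> lattice_of A \<Longrightarrow> - x \<in> lattice_of A"
  using lattice_diff[OF zero_in_lattice] by fastforce

text \<open>Integer vectors come from functions of a finite index type into \<open>int\<close>.
  Countability is what permits summing measures over lattice translates.\<close>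

lemma countable_lattice: "countable (lattice_of A)"
proof -
  have "z \<in> range (\<lambda>f::'a \<Rightarrow> int. \<chi> i. of_int (f i))" if "\<forall>i. z $ i \<in> \<int>" for z :: "real^'a"
    by (rule image_eqI[where x = "\<lambda>i. \<lfloor>z $ i\<rfloor>"]) (use that in \<open>auto simp: vec_eq_iff\<close>)
  then have "{z :: real^'a. \<forall>i. z $ i \<in> \<int>} \<subseteq> range (\<lambda>f::'a \<Rightarrow> int. \<chi> i. of_int (f i))" by auto
  then show ?thesis unfolding lattice_of_def
    by (intro countable_image countable_subset[OF _ countable_image[OF countableI_type]])
qed

text \<open>With \<open>z\<close> the integer vector that defines \<kappa>,
  \<open>transpose A *v \<kappa> = z\<close>, and \<open>A\<close> moves across the inner product as
  its transpose. So the products of \<kappa> with the columns of \<open>A\<close> are its integer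
  coordinates.\<close>

lemma dual_lattice_inner_matrix:
  assumes "invertible A" "\<kappa> \<in> dual_lattice_of A"
  obtains z where "\<forall>i. z $ i \<in> \<int>" "\<And>w. \<kappa> \<bullet> (A *v w) = z \<bullet> w"
proof -
  obtain z where z: "\<forall>i. z $ i \<in> \<int>" "\<kappa> = matrix_inv (transpose A) *v z"
    using assms unfolding dual_lattice_of_def lattice_of_def by auto
  have "transpose A *v \<kappa> = z"
    using assms(1) by (simp add: z matrix_vector_mul_assoc matrix_inv_right transpose_invertible)
  then have "\<kappa> \<bullet> (A *v w) = z \<bullet> w" for w
    by (metis dot_lmul_matrix transpose_matrix_vector)
  with z show ?thesis using that by blast
qed

lemma dual_lattice_inner_Ints:
  assumes "invertible A" "\<kappa> \<in> dual_lattice_of A" "l \<in> lattice_of A"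
  shows "\<kappa> \<bullet> l \<in> \<int>"
proof -
  obtain z where z: "\<forall>i. z $ i \<in> \<int>" "\<And>w. \<kappa> \<bullet> (A *v w) = z \<bullet> w"
    using dual_lattice_inner_matrix assms by blast
  obtain w where "l = A *v w" "\<forall>i. w $ i \<in> \<int>" using assms unfolding lattice_of_def by auto
  with z show ?thesis by (auto simp: inner_vec_def intro!: Ints_sum Ints_mult)
qed

lemma column_in_lattice: "A *v axis j 1 \<in> lattice_of A"
  unfolding lattice_of_def by (auto simp: axis_def)

text \<open>The products with the columns are the entries of \<open>transpose A *v \<kappa>\<close>,
  and \<open>transpose A\<close> is injective.\<close>

lemma inner_columns_eqI:
  fixes A :: "real^'d^'d"
  assumes "invertible A" "\<And>j. \<kappa> \<bullet> (A *v axis j 1) = \<kappa>' \<bullet> (A *v axis j 1)"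
  shows "\<kappa> = \<kappa>'"
proof -
  have "(\<kappa> v* A) $ j = (\<kappa>' v* A) $ j" for j
    using assms(2)[of j] by (simp add: dot_lmul_matrix[symmetric] inner_axis)
  then have "transpose A *v \<kappa> = transpose A *v \<kappa>'" by (simp add: vec_eq_iff)
  then have "matrix_inv (transpose A) *v (transpose A *v \<kappa>) = matrix_inv (transpose A) *v (transpose A *v \<kappa>')"
    by simp
  then show ?thesis
    by (simp only: matrix_vector_mul_assoc matrix_inv_left[OF transpose_invertible[OF assms(1)]]
        matrix_vector_mul_lid)
qed

text \<open>The products with the columns are integers, so their floors \<phi> determine \<kappa>.
  Each takes at most \<open>2 * \<lfloor>R\<rfloor> + 1\<close> values, which is at most
  \<open>3 * R\<close> because \<open>R \<ge> 1\<close>.\<close>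

lemma card_dual_lattice_le:
  fixes A :: "real^'d^'d"
  assumes "invertible A" and F: "F \<subseteq> dual_lattice_of A" and R: "R \<ge> 1"
    and "\<And>\<kappa> j. \<kappa> \<in> F \<Longrightarrow> \<bar>\<kappa> \<bullet> (A *v axis j 1)\<bar> \<le> R"
  shows "real (card F) \<le> (3 * R) ^ CARD('d)"
proof -
  define \<phi> where "\<phi> \<kappa> = (\<lambda>j. \<lfloor>\<kappa> \<bullet> (A *v axis j 1)\<rfloor>)" for \<kappa>
  have Ints: "\<kappa> \<bullet> (A *v axis j 1) \<in> \<int>" if "\<kappa> \<in> F" for \<kappa> j
    using dual_lattice_inner_Ints[OF assms(1) _ column_in_lattice] that F by blast
  have "inj_on \<phi> F"
  proof (rule inj_onI)
    fix x y assume xy: "x \<in> F" "y \<in> F" "\<phi> x = \<phi> y"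
    have "x \<bullet> (A *v axis j 1) = y \<bullet> (A *v axis j 1)" for j
    proof -
      obtain m n where "x \<bullet> (A *v axis j 1) = of_int m" "y \<bullet> (A *v axis j 1) = of_int n"
        using Ints[OF xy(1), of j] Ints[OF xy(2), of j] by (meson Ints_cases)
      with fun_cong[OF xy(3), of j] show ?thesis by (simp add: \<phi>_def)
    qed
    then show "x = y" by (rule inner_columns_eqI[OF assms(1)])
  qed
  moreover have sub: "\<phi> ` F \<subseteq> PiE UNIV (\<lambda>_. {- \<lfloor>R\<rfloor>..\<lfloor>R\<rfloor>})"
  proof clarify
    fix \<kappa> assume \<kappa>: "\<kappa> \<in> F"
    have "\<lfloor>\<kappa> \<bullet> (A *v axis j 1)\<rfloor> \<in> {- \<lfloor>R\<rfloor>..\<lfloor>R\<rfloor>}" for j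
    proof -
      obtain n where n: "\<kappa> \<bullet> (A *v axis j 1) = of_int n" using Ints[OF \<kappa>, of j] by (meson Ints_cases)
      then have "of_int n \<le> R" "of_int (- n) \<le> R" using assms(4)[OF \<kappa>, of j] by auto
      then have "n \<le> \<lfloor>R\<rfloor>" "- n \<le> \<lfloor>R\<rfloor>" by (simp_all only: le_floor_iff)
      with n show ?thesis by simp
    qed
    then show "\<phi> \<kappa> \<in> PiE UNIV (\<lambda>_. {- \<lfloor>R\<rfloor>..\<lfloor>R\<rfloor>})" by (auto simp: \<phi>_def)
  qed
  ultimately have "card F \<le> card (PiE (UNIV :: 'd set) (\<lambda>_. {- \<lfloor>R\<rfloor>..\<lfloor>R\<rfloor>}))"
    by (rule card_inj_on_le) (intro finite_PiE; simp)
  also have "\<dots> = nat (2 * \<lfloor>R\<rfloor> + 1) ^ CARD('d)" by (simp add: card_PiE algebra_simps)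
  finally have "real (card F) \<le> real (nat (2 * \<lfloor>R\<rfloor> + 1)) ^ CARD('d)"
    by (simp only: of_nat_le_iff flip: of_nat_power)
  also have "\<dots> \<le> (3 * R) ^ CARD('d)"
  proof (rule power_mono)
    have "0 \<le> \<lfloor>R\<rfloor>" using R by simp
    then have "real (nat (2 * \<lfloor>R\<rfloor> + 1)) = 2 * real_of_int \<lfloor>R\<rfloor> + 1" by simp
    then show "real (nat (2 * \<lfloor>R\<rfloor> + 1)) \<le> 3 * R" using R of_int_floor_le[of R] by linarith
  qed simp
  finally show ?thesis .
qed

subsection \<open>Translations modulo a lattice\<close>

locale lattice_tiling =
  fixes A :: "real^'d^'d" and \<Omega> :: "(real^'d) set"
  assumes inv: "invertible A" and fd: "fundamental_domain (lattice_of A) \<Omega>"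
begin

abbreviation "L \<equiv> lattice_of A"
abbreviation "\<mu> \<equiv> normalised_measure \<Omega>"

text \<open>The projection onto the quotient by \<open>L\<close>, realised in \<Omega>. Its body
  repeats the description inside \<open>periodic_ext\<close>, so that the periodic extension of
  \<open>f\<close> is \<open>f\<close> composed with \<open>rep\<close>.\<close>

definition rep :: "real^'d \<Rightarrow> real^'d" where
  "rep x = (THE \<omega>. \<omega> \<in> \<Omega> \<and> (\<exists>l\<in>L. x = \<omega> + l))"

lemma periodic_ext_eq: "periodic_ext L \<Omega> f x = f (rep x)"
  by (simp add: periodic_ext_def rep_def)

lemma \<Omega>_sets [measurable]: "\<Omega> \<in> sets lebesgue"
  using fd by (simp add: fundamental_domain_def)

lemma decomp_unique:
  assumes "\<omega> \<in> \<Omega>" "\<omega>' \<in> \<Omega>" "l \<in> L" "l' \<in> L" "\<omega> + l = \<omega>' + l'"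
  shows "\<omega> = \<omega>'" "l = l'"
proof -
  have ex1D: "a = b" if "\<exists>!x. P x" "P a" "P b" for P and a b :: "(real^'d) \<times> (real^'d)"
    using that by blast
  have "\<exists>!q. q \<in> \<Omega> \<times> L \<and> \<omega> + l = fst q + snd q" using fd by (simp add: fundamental_domain_def)
  moreover have "(\<omega>, l) \<in> \<Omega> \<times> L \<and> \<omega> + l = fst (\<omega>, l) + snd (\<omega>, l)"
    and "(\<omega>', l') \<in> \<Omega> \<times> L \<and> \<omega> + l = fst (\<omega>', l') + snd (\<omega>', l')" using assms by auto
  ultimately have "(\<omega>, l) = (\<omega>', l')"
    by (rule ex1D[where P = "\<lambda>q. q \<in> \<Omega> \<times> L \<and> \<omega> + l = fst q + snd q"])
  then show "\<omega> = \<omega>'" "l = l'" by auto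
qed

lemma decomp_ex: "\<exists>\<omega>\<in>\<Omega>. \<exists>l\<in>L. x = \<omega> + l"
proof -
  have "\<exists>!q. q \<in> \<Omega> \<times> L \<and> x = fst q + snd q" using fd by (simp add: fundamental_domain_def)
  then obtain q where "q \<in> \<Omega> \<times> L" "x = fst q + snd q" by (elim ex1E) blast
  then show ?thesis by (cases q) auto
qed

lemma rep_eqI:
  assumes "\<omega> \<in> \<Omega>" "l \<in> L" "x = \<omega> + l"
  shows "rep x = \<omega>"
  unfolding rep_def
proof (rule the_equality)
  fix \<omega>' assume "\<omega>' \<in> \<Omega> \<and> (\<exists>l\<in>L. x = \<omega>' + l)"
  then obtain l' where l': "\<omega>' \<in> \<Omega>" "l' \<in> L" "x = \<omega>' + l'" by blast
  show "\<omega>' = \<omega>" by (rule decomp_unique(1)[OF l'(1) assms(1) l'(2) assms(2)]) (use l'(3) assms(3) in simp)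
qed (use assms in blast)

lemma rep_in: "rep x \<in> \<Omega>"
proof -
  obtain \<omega> l where "\<omega> \<in> \<Omega>" "l \<in> L" "x = \<omega> + l" using decomp_ex[of x] by blast
  then show ?thesis using rep_eqI[of \<omega> l x] by simp
qed

lemma rep_diff: "rep x - x \<in> L"
proof -
  obtain \<omega> l where "\<omega> \<in> \<Omega>" "l \<in> L" "x = \<omega> + l" using decomp_ex[of x] by blast
  then have "rep x = \<omega>" "x = \<omega> + l" "- l \<in> L" using rep_eqI lattice_minus by blast+
  then show ?thesis by simp
qed

lemma rep_eq_iff: "\<omega> \<in> \<Omega> \<Longrightarrow> rep x = \<omega> \<longleftrightarrow> (\<exists>l\<in>L. l + x = \<omega>)"
  (is "_ \<Longrightarrow> ?l \<longleftrightarrow> ?r")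
proof
  assume ?l
  then have "\<omega> - x \<in> L" using rep_diff[of x] by simp
  then show ?r by (intro bexI[of _ "\<omega> - x"]) simp_all
next
  assume \<omega>: "\<omega> \<in> \<Omega>" and ?r
  then obtain l where "l \<in> L" "l + x = \<omega>" by blast
  then show ?l using \<omega> by (intro rep_eqI[of \<omega> "- l"] lattice_minus) auto
qed

text \<open>The translates of \<Omega> by \<open>L\<close> cut \<open>B\<close> into countably many
  disjoint pieces, and moving each piece back into \<Omega> keeps its measure.\<close>

lemma emeasure_tiling:
  assumes B: "B \<in> sets lebesgue"
  shows "emeasure lebesgue B = (\<integral>\<^sup>+l. emeasure lebesgue (\<Omega> \<inter> (+) l -` B) \<partial>count_space L)"
proof -
  have eq: "(+) l ` (\<Omega> \<inter> (+) l -` B) = B \<inter> (+) l ` \<Omega>" for l by auto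
  have "emeasure lebesgue (\<Union>l\<in>L. (+) l ` (\<Omega> \<inter> (+) l -` B))
      = (\<integral>\<^sup>+l. emeasure lebesgue ((+) l ` (\<Omega> \<inter> (+) l -` B)) \<partial>count_space L)"
  proof (rule emeasure_UN_countable)
    show "disjoint_family_on (\<lambda>l. (+) l ` (\<Omega> \<inter> (+) l -` B)) L"
      unfolding disjoint_family_on_def using decomp_unique(2)
      by (auto simp: add.commute)
  qed (auto intro!: lebesgue_sets_translation sets.Int vimage_translation_lebesgue B countable_lattice)
  also have "(\<Union>l\<in>L. (+) l ` (\<Omega> \<inter> (+) l -` B)) = B"
  proof -
    have "x \<in> (\<Union>l\<in>L. (+) l ` \<Omega>)" for x using decomp_ex[of x] by (metis UN_I add.commute imageI)
    then show ?thesis unfolding eq by blast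
  qed
  finally show ?thesis by (simp only: emeasure_lebesgue_translation)
qed

text \<open>At most one point \<open>l + h + x\<close> with \<open>l \<in> L\<close> lies in
  \<Omega>, so the sets are disjoint. \<open>C\<close> is free because it will be \<Omega> itself
  for translation invariance and a second domain for the finiteness of the measure.\<close>

lemma emeasure_Union_translates:
  assumes B: "B \<in> sets lebesgue" "B \<subseteq> \<Omega>" and C: "C \<in> sets lebesgue"
  shows "emeasure lebesgue (\<Union>l\<in>L. C \<inter> (+) (l + h) -` B)
    = (\<integral>\<^sup>+l. emeasure lebesgue (C \<inter> (+) (l + h) -` B) \<partial>count_space L)"
proof (rule emeasure_UN_countable)
  have "l = l'" if "l \<in> L" "l' \<in> L" "l + h + x \<in> \<Omega>" "l' + h + x \<in> \<Omega>" for l l' x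
    using decomp_unique(2)[OF that(3,4), of "- l" "- l'"] that lattice_minus by auto
  then show "disjoint_family_on (\<lambda>l. C \<inter> (+) (l + h) -` B) L"
    unfolding disjoint_family_on_def using B by fastforce
qed (auto intro!: sets.Int vimage_translation_lebesgue B C countable_lattice)

text \<open>Countably many translates of a null set cannot cover the space.\<close>

lemma emeasure_pos: "emeasure lebesgue \<Omega> > 0"
proof (rule ccontr)
  assume "\<not> ?thesis"
  then have "emeasure lebesgue (UNIV :: (real^'d) set) = 0" using emeasure_tiling[of UNIV] by simp
  then show False by simp
qed

end

text \<open>\<open>Q\<close> is the image under \<open>A\<close> of the half-open unit cube: the
  integer parts of the coordinates \<open>matrix_inv A *v x\<close> give the lattice vector, the
  fractional parts the point of \<open>Q\<close>. It serves as a bounded domain to compare \<Omega>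
  with.\<close>

lemma fundamental_domain_parallelepiped:
  fixes A :: "real^'d^'d"
  assumes A: "invertible A"
  defines "Q \<equiv> {x. \<forall>i. 0 \<le> (matrix_inv A *v x) $ i \<and> (matrix_inv A *v x) $ i < 1}"
  shows "fundamental_domain (lattice_of A) Q" "bounded Q"
proof -
  have AA: "matrix_inv A *v (A *v z) = z" "A *v (matrix_inv A *v z) = z" for z
    using A by (simp_all add: matrix_vector_mul_assoc matrix_inv_left matrix_inv_right)
  have "{x. 0 \<le> (matrix_inv A *v x) $ i} \<in> sets lebesgue" "{x. (matrix_inv A *v x) $ i < 1} \<in> sets lebesgue" for i
    by (intro sets_completionI_sets borel_closed borel_open closed_Collect_le open_Collect_less
        continuous_intros linear_continuous_on matrix_vector_mul_bounded_linear; simp)+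
  then have "(\<Inter>i. {x. 0 \<le> (matrix_inv A *v x) $ i} \<inter> {x. (matrix_inv A *v x) $ i < 1}) \<in> sets lebesgue"
    by (intro sets.finite_INT sets.Int) auto
  moreover have "(\<Inter>i. {x. 0 \<le> (matrix_inv A *v x) $ i} \<inter> {x. (matrix_inv A *v x) $ i < 1}) = Q"
    by (auto simp: Q_def)
  ultimately have "Q \<in> sets lebesgue" by simp
  moreover have "\<exists>!q. q \<in> Q \<times> lattice_of A \<and> x = fst q + snd q" for x
  proof -
    define y where "y = matrix_inv A *v x"
    define z :: "real^'d" where "z = (\<chi> i. of_int \<lfloor>y $ i\<rfloor>)"
    have x: "x = A *v y" by (simp add: y_def AA)
    have z: "\<forall>i. z $ i \<in> \<int>" by (simp add: z_def)
    show ?thesis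
    proof (rule ex1I[where a = "(A *v (y - z), A *v z)"])
      have "0 \<le> y $ i - of_int \<lfloor>y $ i\<rfloor> \<and> y $ i - of_int \<lfloor>y $ i\<rfloor> < 1" for i by linarith
      then show "(A *v (y - z), A *v z) \<in> Q \<times> lattice_of A \<and> x = fst (A *v (y - z), A *v z) + snd (A *v (y - z), A *v z)"
        using z by (auto simp: Q_def AA lattice_of_def x matrix_vector_mult_diff_distrib z_def)
    next
      fix q assume q: "q \<in> Q \<times> lattice_of A \<and> x = fst q + snd q"
      then obtain w where w: "snd q = A *v w" "\<forall>i. w $ i \<in> \<int>" unfolding lattice_of_def by auto
      have yq: "y = matrix_inv A *v fst q + w" using q w by (simp add: y_def matrix_vector_right_distrib AA)
      have "w $ i = z $ i" for i
      proof -
        obtain n where n: "w $ i = of_int n" using w(2) by (meson Ints_cases)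
        have "0 \<le> (matrix_inv A *v fst q) $ i" "(matrix_inv A *v fst q) $ i < 1" using q by (auto simp: Q_def)
        then have "\<lfloor>y $ i\<rfloor> = n" unfolding yq by (simp add: n floor_eq_iff)
        then show ?thesis by (simp add: z_def n)
      qed
      then have "w = z" by (simp add: vec_eq_iff)
      with q w show "q = (A *v (y - z), A *v z)"
        by (auto simp: x matrix_vector_mult_diff_distrib prod_eq_iff algebra_simps)
    qed
  qed
  ultimately show "fundamental_domain (lattice_of A) Q" by (simp add: fundamental_domain_def)
  have "Q \<subseteq> (*v) A ` cbox 0 1"
  proof
    fix x assume "x \<in> Q"
    then have "matrix_inv A *v x \<in> cbox 0 1" by (auto simp: Q_def mem_box_cart less_imp_le)
    then show "x \<in> (*v) A ` cbox 0 1" using AA(2)[of x] by (metis imageI)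
  qed
  moreover have "bounded ((*v) A ` cbox 0 1)"
    by (intro bounded_linear_image bounded_cbox matrix_vector_mul_bounded_linear)
  ultimately show "bounded Q" by (rule bounded_subset[rotated])
qed

context lattice_tiling
begin

text \<open>Tiling \<open>\<Omega>\<close> by the bounded domain \<open>Q\<close> cuts \<open>\<Omega>\<close> into pieces whose translates are
  disjoint subsets of \<open>Q\<close>.\<close>

lemma emeasure_finite: "emeasure lebesgue \<Omega> < \<infinity>"
proof -
  define Q where "Q = {x. \<forall>i. 0 \<le> (matrix_inv A *v x) $ i \<and> (matrix_inv A *v x) $ i < 1}"
  note Q = fundamental_domain_parallelepiped[OF inv, folded Q_def]
  interpret Q: lattice_tiling A Q by standard (fact inv, fact Q)
  \<comment> \<open>Both domains act here: tiling by \<open>Q\<close> gives the summands, and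
    uniqueness of representatives in \<Omega> makes the pieces disjoint. The summand 0 is the shift
    \<open>h = 0\<close>.\<close>
  have "emeasure lebesgue \<Omega> = emeasure lebesgue (\<Union>l\<in>L. Q \<inter> (+) (l + 0) -` \<Omega>)"
    unfolding emeasure_Union_translates[OF \<Omega>_sets subset_refl Q.\<Omega>_sets]
    by (simp only: Q.emeasure_tiling[OF \<Omega>_sets] add_0_right)
  also have "\<dots> \<le> emeasure lebesgue Q" by (intro emeasure_mono Q.\<Omega>_sets) auto
  also have "\<dots> < \<infinity>" 
    using fmeasurableD2[OF bounded_set_imp_lmeasurable[OF Q(2) Q.\<Omega>_sets]]
    by (metis infinity_ennreal_def less_top)
  finally show ?thesis .
qed

lemma measure_pos: "measure lebesgue \<Omega> > 0"
  unfolding measure_def using emeasure_pos emeasure_finite by (simp only: enn2real_positive_iff infinity_ennreal_def)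

section \<open>The normalised measure as a probability measure on the fundamental domain\<close>

lemma space_\<mu> [simp]: "space \<mu> = \<Omega>"
  by (simp add: normalised_measure_def)

lemma sets_\<mu>: "sets \<mu> = sets (lebesgue_on \<Omega>)"
  by (simp add: normalised_measure_def)

lemma in_sets_\<mu>_iff: "B \<in> sets \<mu> \<longleftrightarrow> B \<subseteq> \<Omega> \<and> B \<in> sets lebesgue"
  unfolding sets_\<mu> by (auto simp: sets_restrict_space_iff)

lemma \<Omega>_in_sets_\<mu>: "\<Omega> \<in> sets \<mu>"
  by (simp only: in_sets_\<mu>_iff \<Omega>_sets) simp

lemma emeasure_\<mu>:
  assumes "B \<in> sets \<mu>"
  shows "emeasure \<mu> B = emeasure lebesgue B / emeasure lebesgue \<Omega>"
proof -
  have B: "B \<subseteq> \<Omega>" "B \<in> sets lebesgue" using assms by (simp_all only: in_sets_\<mu>_iff)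
  then have "emeasure \<mu> B = emeasure (lebesgue_on \<Omega>) (\<Omega> \<inter> B) / emeasure (lebesgue_on \<Omega>) \<Omega>"
    unfolding normalised_measure_def
    by (intro emeasure_uniform_measure) (auto simp: sets_restrict_space_iff)
  with B show ?thesis by (simp add: emeasure_restrict_space Int_absorb1)
qed

lemma finite_measure_\<mu>: "finite_measure \<mu>"
proof
  have "emeasure \<mu> (space \<mu>) = emeasure lebesgue \<Omega> / emeasure lebesgue \<Omega>"
    by (simp only: space_\<mu> emeasure_\<mu> \<Omega>_in_sets_\<mu>)
  also have "\<dots> = 1" using emeasure_pos emeasure_finite by (intro ennreal_divide_self) auto
  finally show "emeasure \<mu> (space \<mu>) \<noteq> \<infinity>" by simp
qed

lemma measure_\<mu>_\<Omega>: "measure \<mu> \<Omega> = 1"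
proof -
  have "emeasure \<mu> \<Omega> = emeasure lebesgue \<Omega> / emeasure lebesgue \<Omega>"
    by (simp only: space_\<mu> emeasure_\<mu> \<Omega>_in_sets_\<mu>)
  also have "\<dots> = 1" using emeasure_pos emeasure_finite by (intro ennreal_divide_self) auto
  finally show ?thesis by (simp add: measure_def)
qed

text \<open>\<mu> has constant density \<open>1 / measure lebesgue \<Omega>\<close>, which is finite
  and positive. This links \<mu> to the explicit factor in \<open>fourier_coeff\<close>.\<close>

lemma integral_\<mu>:
  fixes g :: "real^'d \<Rightarrow> complex"
  assumes "g \<in> borel_measurable \<mu>"
  shows "(LINT x|\<mu>. g x) = 1 / complex_of_real (measure lebesgue \<Omega>) * (LINT x|lebesgue_on \<Omega>. g x)"
proof -
  have g: "g \<in> borel_measurable (lebesgue_on \<Omega>)"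
    using assms measurable_cong_sets[OF sets_\<mu> refl] by blast
  have "emeasure lebesgue \<Omega> = ennreal (measure lebesgue \<Omega>)"
    using emeasure_finite by (intro emeasure_eq_ennreal_measure) auto
  then have em: "emeasure (lebesgue_on \<Omega>) \<Omega> = ennreal (measure lebesgue \<Omega>)"
    by (simp add: emeasure_restrict_space)
  have "\<mu> = density (lebesgue_on \<Omega>) (\<lambda>_. ennreal (1 / measure lebesgue \<Omega>))"
    unfolding normalised_measure_def uniform_measure_def em
  proof (rule density_cong)
    have [measurable]: "\<Omega> \<in> sets (lebesgue_on \<Omega>)" by (simp add: sets_restrict_space_iff)
    show "(\<lambda>x. indicator \<Omega> x / ennreal (measure lebesgue \<Omega>)) \<in> borel_measurable (lebesgue_on \<Omega>)"
      by measurable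
  qed (use measure_pos in \<open>auto simp: divide_ennreal[symmetric] intro!: AE_I2\<close>)
  then have "(LINT x|\<mu>. g x) = (LINT x|lebesgue_on \<Omega>. (1 / measure lebesgue \<Omega>) *\<^sub>R g x)"
    using g by (simp add: integral_density)
  then show ?thesis by (simp add: scaleR_conv_of_real)
qed

section \<open>Invariance of the normalised measure under translation modulo the lattice\<close>

lemma rep_translate_vimage:
  assumes "B \<subseteq> \<Omega>"
  shows "(\<lambda>x. rep (x + h)) -` B \<inter> \<Omega> = (\<Union>l\<in>L. \<Omega> \<inter> (+) (l + h) -` B)"
proof -
  have "rep (x + h) \<in> B \<longleftrightarrow> (\<exists>l\<in>L. l + h + x \<in> B)" for x
  proof
    assume "rep (x + h) \<in> B"
    moreover obtain l where "l \<in> L" "l + (x + h) = rep (x + h)"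
      using rep_eq_iff[OF rep_in, of "x + h" "x + h"] by auto
    ultimately show "\<exists>l\<in>L. l + h + x \<in> B" by (intro bexI[of _ l]) (simp_all add: add_ac)
  next
    assume "\<exists>l\<in>L. l + h + x \<in> B"
    then obtain l where l: "l \<in> L" "l + h + x \<in> B" by blast
    then have "rep (x + h) = l + h + x"
      using assms by (subst rep_eq_iff) (auto intro!: bexI[of _ l] simp: add_ac)
    with l show "rep (x + h) \<in> B" by simp
  qed
  then show ?thesis by auto
qed

lemma rep_translate_measurable: "(\<lambda>x. rep (x + h)) \<in> measurable \<mu> \<mu>"
proof (rule measurableI)
  fix B assume "B \<in> sets \<mu>"
  then have B: "B \<subseteq> \<Omega>" "B \<in> sets lebesgue" by (auto simp: in_sets_\<mu>_iff)
  have "(\<Union>l\<in>L. \<Omega> \<inter> (+) (l + h) -` B) \<in> sets lebesgue"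
    by (intro sets.countable_UN'' countable_lattice sets.Int vimage_translation_lebesgue B \<Omega>_sets)
  then show "(\<lambda>x. rep (x + h)) -` B \<inter> space \<mu> \<in> sets \<mu>"
    unfolding in_sets_\<mu>_iff by (auto simp: rep_translate_vimage B)
qed (simp add: rep_in)

text \<open>The preimage of \<open>B\<close> is the disjoint union of the parts of \<Omega> that
  some \<open>l + h\<close> moves into \<open>B\<close>. By the tiling formula their measures add up
  to that of \<open>B\<close> shifted by \<open>- h\<close>, hence to that of
  \<open>B\<close>.\<close>

lemma distr_rep_translate: "distr \<mu> \<mu> (\<lambda>x. rep (x + h)) = \<mu>"
proof (rule measure_eqI)
  fix B assume "B \<in> sets (distr \<mu> \<mu> (\<lambda>x. rep (x + h)))"
  then have B\<mu>: "B \<in> sets \<mu>" by simp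
  then have B: "B \<subseteq> \<Omega>" "B \<in> sets lebesgue" by (auto simp: in_sets_\<mu>_iff)
  have vim: "(+) (l + h) -` B = (+) l -` ((+) h -` B)" for l by (auto simp: add_ac)
  have "emeasure lebesgue (\<Union>l\<in>L. \<Omega> \<inter> (+) (l + h) -` B) = emeasure lebesgue ((+) h -` B)"
    unfolding emeasure_Union_translates[OF B(2,1) \<Omega>_sets]
    by (subst emeasure_tiling[OF vimage_translation_lebesgue[OF B(2)]]) (simp only: vim)
  then have eq: "emeasure lebesgue ((\<lambda>x. rep (x + h)) -` B \<inter> \<Omega>) = emeasure lebesgue B"
    by (simp only: rep_translate_vimage[OF B(1)] emeasure_lebesgue_vimage_translation)
  have "(\<lambda>x. rep (x + h)) -` B \<inter> \<Omega> \<in> sets \<mu>"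
    using measurable_sets[OF rep_translate_measurable B\<mu>] by simp
  then show "emeasure (distr \<mu> \<mu> (\<lambda>x. rep (x + h))) B = emeasure \<mu> B"
    using eq emeasure_\<mu> B\<mu> by (simp add: emeasure_distr[OF rep_translate_measurable B\<mu>])
qed simp

lemma integral_rep_translate:
  fixes g :: "real^'d \<Rightarrow> 'b::{banach, second_countable_topology}"
  assumes "g \<in> borel_measurable \<mu>"
  shows "(LINT x|\<mu>. g (rep (x + h))) = (LINT x|\<mu>. g x)"
  using integral_distr[OF rep_translate_measurable assms, of h] by (simp add: distr_rep_translate)

lemma integrable_rep_translate:
  fixes g :: "real^'d \<Rightarrow> 'b::{banach, second_countable_topology}"
  assumes "integrable \<mu> g"
  shows "integrable \<mu> (\<lambda>x. g (rep (x + h)))"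
  using integrable_distr[OF rep_translate_measurable[of h], where f = g] assms by (simp add: distr_rep_translate)

end

subsection \<open>Fourier coefficients of Lipschitz functions\<close>

context lattice_tiling
begin

section \<open>Characters of the dual lattice and their orthonormality\<close>

definition chi :: "real^'d \<Rightarrow> real^'d \<Rightarrow> complex" where
  "chi \<kappa> x = exp (- 2 * complex_of_real pi * \<i> * complex_of_real (\<kappa> \<bullet> x))"

lemma chi_cis: "chi \<kappa> x = cis (- (2 * pi * (\<kappa> \<bullet> x)))"
  by (simp add: chi_def cis_conv_exp mult_ac)

lemma norm_chi [simp]: "norm (chi \<kappa> x) = 1"
  by (simp add: chi_cis)

lemma chi_add: "chi \<kappa> (x + y) = chi \<kappa> x * chi \<kappa> y"
  by (simp add: chi_cis cis_mult inner_add_right algebra_simps)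

lemma chi_mult_cnj: "chi \<kappa> x * cnj (chi \<kappa>' x) = chi (\<kappa> - \<kappa>') x"
  by (simp add: chi_cis cis_cnj cis_mult inner_diff_left algebra_simps)

lemma chi_lattice:
  assumes "\<kappa> \<in> dual_lattice_of A" "l \<in> L"
  shows "chi \<kappa> l = 1"
  using dual_lattice_inner_Ints[OF inv assms] cis_multiple_2pi[of "- (\<kappa> \<bullet> l)"] by (simp add: chi_cis)

lemma chi_rep:
  assumes "\<kappa> \<in> dual_lattice_of A"
  shows "chi \<kappa> (rep x) = chi \<kappa> x"
  using chi_add[of \<kappa> x "rep x - x"] chi_lattice[OF assms rep_diff] by simp

lemma chi_measurable [measurable]: "chi \<kappa> \<in> borel_measurable \<mu>"
proof -
  have "continuous_on UNIV (chi \<kappa>)" unfolding chi_def by (intro continuous_intros)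
  then have "chi \<kappa> \<in> borel_measurable lebesgue"
    by (intro measurable_completion) (simp add: borel_measurable_continuous_onI)
  then show ?thesis
    using measurable_cong_sets[OF sets_\<mu> refl] measurable_restrict_space1 by blast
qed

text \<open>For nonzero \<kappa> the vector \<open>h\<close> satisfies
  \<open>\<kappa> \<bullet> h = 1 / 2\<close>, so translation by \<open>h\<close> changes the sign
  of the character while it preserves the integral.\<close>

lemma integral_chi:
  assumes "\<kappa> \<in> dual_lattice_of A"
  shows "(LINT x|\<mu>. chi \<kappa> x) = (if \<kappa> = 0 then 1 else 0)"
proof (cases "\<kappa> = 0")
  case True
  then show ?thesis using measure_\<mu>_\<Omega> by (simp add: chi_cis)
next
  case False
  define h where "h = (1 / (2 * (\<kappa> \<bullet> \<kappa>))) *\<^sub>R \<kappa>"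
  have "chi \<kappa> h = - 1" using False by (simp add: chi_cis h_def cis.ctr complex_eq_iff)
  then have "chi \<kappa> (rep (x + h)) = - chi \<kappa> x" for x
    by (simp add: chi_rep[OF assms] chi_add)
  then have "(LINT x|\<mu>. chi \<kappa> x) = - (LINT x|\<mu>. chi \<kappa> x)"
    using integral_rep_translate[OF chi_measurable, of \<kappa> h] by simp
  then show ?thesis using False by simp
qed

lemma dual_lattice_diff:
  "\<kappa> \<in> dual_lattice_of A \<Longrightarrow> \<kappa>' \<in> dual_lattice_of A \<Longrightarrow> \<kappa> - \<kappa>' \<in> dual_lattice_of A"
  unfolding dual_lattice_of_def by (rule lattice_diff)

lemma chi_orthonormal:
  assumes "\<kappa> \<in> dual_lattice_of A" "\<kappa>' \<in> dual_lattice_of A"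
  shows "(LINT x|\<mu>. chi \<kappa> x * cnj (chi \<kappa>' x)) = (if \<kappa> = \<kappa>' then 1 else 0)"
  by (simp add: chi_mult_cnj integral_chi[OF dual_lattice_diff[OF assms]])

lemma fourier_coeff_eq:
  assumes [measurable]: "f \<in> borel_measurable \<mu>"
  shows "fourier_coeff \<Omega> f \<kappa> = (LINT x|\<mu>. f x * chi \<kappa> x)"
proof -
  have "(\<lambda>x. f x * chi \<kappa> x) \<in> borel_measurable \<mu>" by measurable
  from integral_\<mu>[OF this] show ?thesis by (simp only: fourier_coeff_def chi_def)
qed

lemma integrable_mult_chi:
  assumes "integrable \<mu> f"
  shows "integrable \<mu> (\<lambda>x. f x * chi \<kappa> x)"
proof (rule Bochner_Integration.integrable_bound[OF assms])
  have [measurable]: "f \<in> borel_measurable \<mu>" using assms by simp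
  show "(\<lambda>x. f x * chi \<kappa> x) \<in> borel_measurable \<mu>" by measurable
qed (simp add: norm_mult)

text \<open>The difference of periodic extensions from \<open>Lip_space\<close>. The second term
  also passes through \<open>rep\<close>, which fixes the points of \<Omega>.\<close>

definition increment :: "(real^'d \<Rightarrow> complex) \<Rightarrow> real^'d \<Rightarrow> real^'d \<Rightarrow> complex" where
  "increment f h x = f (rep (x + h)) - f (rep x)"

lemma increment_measurable [measurable]:
  assumes "f \<in> borel_measurable \<mu>"
  shows "increment f h \<in> borel_measurable \<mu>"
  unfolding increment_def
  using measurable_compose[OF rep_translate_measurable[of h] assms]
    measurable_compose[OF rep_translate_measurable[of 0] assms] by simp

text \<open>Periodicity turns \<open>f (rep (x + h)) * chi \<kappa> x\<close> into
  \<open>chi \<kappa> (- h)\<close> times the translate of \<open>f * chi \<kappa>\<close>;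
  invariance of the integral then removes the translation.\<close>

lemma integral_increment_chi:
  assumes f: "integrable \<mu> f" and \<kappa>: "\<kappa> \<in> dual_lattice_of A"
  shows "(LINT x|\<mu>. increment f h x * chi \<kappa> x) = (chi \<kappa> (- h) - 1) * (LINT x|\<mu>. f x * chi \<kappa> x)"
proof -
  define g where "g x = f x * chi \<kappa> x" for x
  have g: "integrable \<mu> g" unfolding g_def by (rule integrable_mult_chi[OF f])
  have chi_h: "chi \<kappa> (x + h) * chi \<kappa> (- h) = chi \<kappa> x" for x
    by (simp flip: chi_add)
  \<comment> \<open>The form \<open>x + 0\<close> presents the second term as a translate too, so
    that one invariance lemma serves both.\<close>
  have "increment f h x * chi \<kappa> x = chi \<kappa> (- h) * g (rep (x + h)) - g (rep (x + 0))" for x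
  proof -
    have eq: "chi \<kappa> (- h) * g (rep (x + h)) = f (rep (x + h)) * (chi \<kappa> (x + h) * chi \<kappa> (- h))"
      unfolding g_def chi_rep[OF \<kappa>] by (simp only: mult_ac)
    show ?thesis
      unfolding eq chi_h by (simp add: increment_def g_def chi_rep[OF \<kappa>] left_diff_distrib)
  qed
  then have "(LINT x|\<mu>. increment f h x * chi \<kappa> x)
      = chi \<kappa> (- h) * (LINT x|\<mu>. g (rep (x + h))) - (LINT x|\<mu>. g (rep (x + 0)))"
    using integrable_rep_translate[OF g] by (simp del: add_0_right)
  also have "\<dots> = (chi \<kappa> (- h) - 1) * (LINT x|\<mu>. g x)"
    using g by (simp add: integral_rep_translate algebra_simps del: add_0_right)
  finally show ?thesis by (simp add: g_def)
qed

text \<open>The angle lies between \<open>pi / 2\<close> and \<open>pi\<close> up to sign, so the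
  real part of the character is at most 0 and its distance from 1 at least 1.\<close>

lemma norm_chi_minus_one:
  assumes "1 / 4 \<le> \<bar>\<kappa> \<bullet> h\<bar>" "\<bar>\<kappa> \<bullet> h\<bar> \<le> 1 / 2"
  shows "1 \<le> norm (chi \<kappa> (- h) - 1)"
proof -
  define \<theta> where "\<theta> = 2 * pi * \<bar>\<kappa> \<bullet> h\<bar>"
  have "pi * (1 / 2) \<le> pi * (2 * \<bar>\<kappa> \<bullet> h\<bar>)" "pi * (2 * \<bar>\<kappa> \<bullet> h\<bar>) \<le> pi * 1"
    using assms by (intro mult_left_mono; simp)+
  then have \<theta>: "pi / 2 \<le> \<theta>" "\<theta> \<le> pi" by (simp_all add: \<theta>_def mult_ac)
  have "\<theta> = \<bar>2 * pi * (\<kappa> \<bullet> h)\<bar>" by (simp add: \<theta>_def abs_mult)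
  then have "Re (chi \<kappa> (- h)) = cos \<theta>" by (simp add: chi_cis)
  also have "\<dots> \<le> cos (pi / 2)" using \<theta> by (intro cos_monotone_0_pi_le) auto
  finally have "Re (chi \<kappa> (- h)) \<le> 0" by simp
  moreover have "\<bar>Re (chi \<kappa> (- h) - 1)\<bar> \<le> norm (chi \<kappa> (- h) - 1)" by (rule abs_Re_le_cmod)
  ultimately show ?thesis by simp
qed

text \<open>The p-th power of \<open>norm (a - b)\<close> is at most \<open>2 powr p\<close> times
  the sum of the p-th powers, and both translates of \<open>f\<close> inherit integrability from
  \<open>f\<close>.\<close>

lemma integrable_increment_powr:
  assumes [measurable]: "f \<in> borel_measurable \<mu>" and f: "integrable \<mu> (\<lambda>x. norm (f x) powr p)" and p: "p \<ge> 1"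
  shows "integrable \<mu> (\<lambda>x. norm (increment f h x) powr p)"
proof (rule Bochner_Integration.integrable_bound)
  let ?g = "\<lambda>x. 2 powr p * (norm (f (rep (x + h))) powr p + norm (f (rep (x + 0))) powr p)"
  show "integrable \<mu> ?g"
    by (intro integrable_mult_right Bochner_Integration.integrable_add integrable_rep_translate[where g = "\<lambda>x. norm (f x) powr p"] f)
  have "norm (norm (a - b) powr p) \<le> norm (2 powr p * (norm a powr p + norm b powr p))" for a b :: complex
  proof -
    have "norm (a - b) \<le> 2 * max (norm a) (norm b)" using norm_triangle_ineq4[of a b] by linarith
    then have "norm (a - b) powr p \<le> (2 * max (norm a) (norm b)) powr p" using p by (intro powr_mono2) auto
    also have "\<dots> = 2 powr p * max (norm a) (norm b) powr p" by (simp add: powr_mult)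
    also have "\<dots> \<le> 2 powr p * (norm a powr p + norm b powr p)"
      by (intro mult_left_mono) (auto simp: max_def)
    finally show ?thesis by (simp del: powr_mult_base)
  qed
  then show "AE x in \<mu>. norm (norm (increment f h x) powr p) \<le> norm (?g x)"
    by (simp add: increment_def)
qed measurable

text \<open>On a shell some coordinate \<open>\<kappa> \<bullet> (A *v axis j 1)\<close> has size about \<open>R\<close>, so translation by
  \<open>h = (1 / (4 * R)) *\<^sub>R (A *v axis j 1)\<close> makes the factor \<open>chi \<kappa> (- h) - 1\<close> at least 1 in modulus.\<close>

lemma card_shell_le:
  assumes p: "1 < p" "p \<le> 2" "1 / p + 1 / q = 1"
    and f_meas [measurable]: "f \<in> borel_measurable \<mu>" and f_int: "integrable \<mu> (\<lambda>x. norm (f x) powr p)"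
    and C: "C > 0" and \<alpha>: "\<alpha> > 0"
    and Lip: "\<And>h. norm h < \<delta> \<Longrightarrow>
        (LINT x|\<mu>. norm (increment f h x) powr p) \<le> (C * norm h powr \<alpha>) powr p"
    and V: "V > 0" "\<And>j. norm (A *v axis j 1) \<le> V" and R: "R > 0" "V / (4 * R) < \<delta>"
    and F: "finite F" "F \<subseteq> dual_lattice_of A" and t: "t > 0" "\<And>\<kappa>. \<kappa> \<in> F \<Longrightarrow> t \<le> norm (fourier_coeff \<Omega> f \<kappa>)"
    and shell: "\<And>\<kappa>. \<kappa> \<in> F \<Longrightarrow> \<exists>j. R \<le> \<bar>\<kappa> \<bullet> (A *v axis j 1)\<bar> \<and> \<bar>\<kappa> \<bullet> (A *v axis j 1)\<bar> \<le> 2 * R"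
  shows "real (card F) \<le> real CARD('d) * (C * (V / (4 * R)) powr \<alpha> / t) powr q"
proof -
  have fi: "integrable \<mu> f"
    using integrable_of_integrable_powr[OF finite_measure_\<mu> _ f_meas f_int] p by simp
  define B where "B = C * (V / (4 * R)) powr \<alpha>"
  have B: "B > 0" using C V R by (simp add: B_def)
  \<comment> \<open>The shell is split by a column whose product with \<kappa> has the right size,
    since one \<open>h\<close> must serve all frequencies in an application of the weak inequality.
    The sum over the columns costs the factor \<open>CARD('d)\<close>.\<close>
  define G where "G j = {\<kappa> \<in> F. R \<le> \<bar>\<kappa> \<bullet> (A *v axis j 1)\<bar> \<and> \<bar>\<kappa> \<bullet> (A *v axis j 1)\<bar> \<le> 2 * R}" for j
  have G_le: "real (card (G j)) \<le> (B / t) powr q" for j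
  proof -
    define h where "h = (1 / (4 * R)) *\<^sub>R (A *v axis j 1)"
    have h_le: "norm h \<le> V / (4 * R)" using V(2)[of j] R by (simp add: h_def divide_right_mono)
    have "norm h powr \<alpha> \<le> (V / (4 * R)) powr \<alpha>" using h_le \<alpha> by (intro powr_mono2) auto
    then have "(C * norm h powr \<alpha>) powr p \<le> B powr p" using C p by (intro powr_mono2) (auto simp: B_def)
    then have int_le: "(LINT x|\<mu>. norm (increment f h x) powr p) \<le> B powr p"
      using Lip[of h] h_le R by simp
    have GF: "G j \<subseteq> dual_lattice_of A" using F by (auto simp: G_def)
    show ?thesis
    proof (rule weak_Hausdorff_Young[where e = chi and g = "increment f h" and M = \<mu>])
      show "finite (G j)" using F by (simp add: G_def)
      show "(LINT x|\<mu>. chi k x * cnj (chi l x)) = (if k = l then 1 else 0)" if "k \<in> G j" "l \<in> G j" for k l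
        using chi_orthonormal that GF by blast
      show "t \<le> norm (LINT x|\<mu>. increment f h x * chi \<kappa> x)" if "\<kappa> \<in> G j" for \<kappa>
      proof -
        have \<kappa>: "\<kappa> \<in> dual_lattice_of A" "\<kappa> \<in> F" using that GF by (auto simp: G_def)
        have eq: "\<bar>\<kappa> \<bullet> h\<bar> = \<bar>\<kappa> \<bullet> (A *v axis j 1)\<bar> / (4 * R)" using R by (simp add: h_def abs_mult)
        have "1 \<le> norm (chi \<kappa> (- h) - 1)"
          by (rule norm_chi_minus_one; unfold eq) (use that R(1) in \<open>simp_all add: G_def field_simps\<close>)
        then have "1 * norm (fourier_coeff \<Omega> f \<kappa>) \<le> norm (chi \<kappa> (- h) - 1) * norm (fourier_coeff \<Omega> f \<kappa>)"
          by (intro mult_right_mono) auto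
        then show ?thesis
          using t(2)[OF \<kappa>(2)] by (simp add: integral_increment_chi[OF fi \<kappa>(1)] fourier_coeff_eq norm_mult)
      qed
      show "integrable \<mu> (\<lambda>x. norm (increment f h x) powr p)"
        using integrable_increment_powr[OF f_meas f_int] p by simp
    qed (use p t B int_le finite_measure_\<mu> in auto)
  qed
  have "F \<subseteq> (\<Union>j. G j)" using shell by (auto simp: G_def)
  then have "card F \<le> card (\<Union>j. G j)" using F by (intro card_mono) (auto simp: G_def)
  also have "\<dots> \<le> (\<Sum>j\<in>UNIV. card (G j))" by (rule card_UN_le) simp
  finally have "real (card F) \<le> (\<Sum>j\<in>UNIV. real (card (G j)))" by (simp flip: of_nat_sum)
  also have "\<dots> \<le> (\<Sum>j\<in>(UNIV::'d set). (B / t) powr q)" by (intro sum_mono G_le)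
  finally show ?thesis by (simp add: B_def)
qed

text \<open>Frequencies up to \<open>R\<close> are counted as lattice points, those beyond through
  dyadic shells, whose bounds form a geometric series. \<open>R\<close> is chosen so that both parts
  have order \<open>t powr (- \<gamma>)\<close>.\<close>

lemma card_large_coeffs_le:
  assumes p: "1 < p" "p \<le> 2" "1 / p + 1 / q = 1"
    and f_meas: "f \<in> borel_measurable \<mu>" and f_int: "integrable \<mu> (\<lambda>x. norm (f x) powr p)"
    and C: "C > 0" and \<alpha>: "\<alpha> > 0" and \<delta>: "\<delta> > 0" and T: "T > 0"
    and Lip: "\<And>h. norm h < \<delta> \<Longrightarrow>
        (LINT x|\<mu>. norm (increment f h x) powr p) \<le> (C * norm h powr \<alpha>) powr p"
    and \<gamma>: "\<gamma> = q / (1 + \<alpha> * q / real CARD('d))"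
  shows "\<exists>K\<ge>0. \<forall>t F. 0 < t \<longrightarrow> t \<le> T \<longrightarrow> finite F \<longrightarrow> F \<subseteq> dual_lattice_of A \<longrightarrow>
       (\<forall>\<kappa>\<in>F. t \<le> norm (fourier_coeff \<Omega> f \<kappa>)) \<longrightarrow> real (card F) \<le> K * t powr (- \<gamma>)"
proof -
  define d where "d = real CARD('d)"
  have d: "d > 0" by (simp add: d_def)
  have q: "q > 0" using p by (smt (verit) divide_less_eq_1_pos zero_less_divide_1_iff)
  have \<gamma>0: "\<gamma> > 0" using q \<alpha> d unfolding \<gamma> d_def by (intro divide_pos_pos add_pos_pos) auto
  \<comment> \<open>The balance of exponents: for \<open>R\<close> proportional to
    \<open>t powr (- (\<gamma> / d))\<close>, the shell bound
    \<open>(R powr (- \<alpha>) / t) powr q\<close> has the same order as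
    \<open>R powr d\<close>.\<close>
  have \<gamma>_eq: "\<gamma> / d * \<alpha> * q - q = - \<gamma>"
  proof -
    have "\<gamma> * (1 + \<alpha> * q / d) = q" unfolding \<gamma> d_def[symmetric]
      using add_pos_pos[OF zero_less_one divide_pos_pos[OF mult_pos_pos[OF \<alpha> q] d]] by simp
    then show ?thesis by (simp add: algebra_simps)
  qed
  define V where "V = 1 + (\<Sum>j\<in>UNIV. norm (A *v axis j 1))"
  have V: "V > 0" "norm (A *v axis j 1) \<le> V" for j
  proof -
    show "V > 0" unfolding V_def by (intro add_pos_nonneg sum_nonneg) auto
    have "norm (A *v axis j 1) \<le> (\<Sum>j\<in>UNIV. norm (A *v axis j 1))" by (rule member_le_sum) auto
    then show "norm (A *v axis j 1) \<le> V" by (simp add: V_def)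
  qed
  \<comment> \<open>A lower bound for \<open>R\<close>: it gives \<open>R \<ge> 1\<close> for the
    lattice count and keeps every translation, of length at most \<open>V / (4 * R)\<close>, below
    \<delta>. The factor of \<open>T\<close> in \<rho> secures \<open>R \<ge> r\<close> for all
    \<open>t \<le> T\<close>.\<close>
  define r where "r = 1 + V / \<delta>"
  have r: "r \<ge> 1" "V < r * \<delta>" using V \<delta> by (auto simp: r_def field_simps)
  define \<rho> where "\<rho> = r * T powr (\<gamma> / d)"
  have \<rho>: "\<rho> > 0" using r T by (simp add: \<rho>_def)
  define s where "s = (2::real) powr (- (\<alpha> * q))"
  have s: "0 < s" "s < 1" using \<alpha> q powr_less_mono[of "- (\<alpha> * q)" 0 2] by (auto simp: s_def)
  define Z where "Z = d * (C * (V / 4) powr \<alpha> * \<rho> powr (- \<alpha>)) powr q"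
  have Z: "Z \<ge> 0" using d by (simp add: Z_def)
  define K where "K = (3 * \<rho>) powr d + Z * (1 / (1 - s))"
  show ?thesis
  proof (intro exI[of _ K] conjI allI impI)
    show "K \<ge> 0" using Z s by (simp add: K_def)
  next
    fix t :: real and F
    assume t: "0 < t" "t \<le> T" and F: "finite F" "F \<subseteq> dual_lattice_of A"
      and large: "\<forall>\<kappa>\<in>F. t \<le> norm (fourier_coeff \<Omega> f \<kappa>)"
    define R where "R = \<rho> * t powr (- (\<gamma> / d))"
    have R_ge: "R \<ge> r"
    proof -
      have "1 \<le> (T / t) powr (\<gamma> / d)" using t \<gamma>0 d by (intro ge_one_powr_ge_zero) (auto simp: field_simps)
      then have "r * 1 \<le> r * (T / t) powr (\<gamma> / d)" using r by (intro mult_left_mono) auto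
      also have "\<dots> = R" using t T by (simp add: R_def \<rho>_def powr_divide powr_minus_divide)
      finally show ?thesis by simp
    qed
    have R: "R \<ge> 1" using R_ge r by simp
    \<comment> \<open>The sup norm of the integer coordinates of \<kappa>; the maximum is attained,
      which supplies the column for the shell bound.\<close>
    define n where "n \<kappa> = Max (range (\<lambda>j. \<bar>\<kappa> \<bullet> (A *v axis j 1)\<bar>))" for \<kappa>
    have n_ge: "\<bar>\<kappa> \<bullet> (A *v axis j 1)\<bar> \<le> n \<kappa>" for \<kappa> j
      unfolding n_def by (rule Max_ge) auto
    have n_ex: "\<exists>j. \<bar>\<kappa> \<bullet> (A *v axis j 1)\<bar> = n \<kappa>" for \<kappa>
      using Max_in[of "range (\<lambda>j. \<bar>\<kappa> \<bullet> (A *v axis j 1)\<bar>)"] unfolding n_def by (simp add: image_iff) metis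
    define F0 where "F0 = {\<kappa> \<in> F. n \<kappa> \<le> R}"
    define S where "S k = {\<kappa> \<in> F. 2 ^ k * R \<le> n \<kappa> \<and> n \<kappa> \<le> 2 ^ Suc k * R}" for k :: nat
    have "\<exists>k. \<kappa> \<in> S k" if "\<kappa> \<in> F - F0" for \<kappa>
    proof -
      have "R \<le> n \<kappa>" "0 < R" using that R by (auto simp: F0_def)
      \<comment> \<open>The dyadic lemma is applied with \<open>n \<kappa>\<close> as the upper
        value and \<open>R\<close> as the level.\<close>
      obtain k where "n \<kappa> / 2 ^ Suc k \<le> R" "R \<le> n \<kappa> / 2 ^ k"
        by (rule dyadic_level[OF \<open>0 < R\<close> \<open>R \<le> n \<kappa>\<close>])
      then have "\<kappa> \<in> S k" using that by (simp add: S_def divide_le_eq le_divide_eq mult.commute)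
      then show ?thesis ..
    qed
    then obtain k where k: "\<And>\<kappa>. \<kappa> \<in> F - F0 \<Longrightarrow> \<kappa> \<in> S (k \<kappa>)" by metis
    define J where "J = Suc (Max (insert 0 (k ` F)))"
    have kJ: "k \<kappa> < J" if "\<kappa> \<in> F" for \<kappa> using F that by (simp add: J_def le_imp_less_Suc)
    have "F \<subseteq> F0 \<union> (\<Union>i<J. S i)" using k kJ by blast
    then have "card F \<le> card (F0 \<union> (\<Union>i<J. S i))" using F by (intro card_mono) (auto simp: F0_def S_def)
    also have "\<dots> \<le> card F0 + card (\<Union>i<J. S i)" by (rule card_Un_le)
    also have "\<dots> \<le> card F0 + (\<Sum>i<J. card (S i))" by (intro add_left_mono card_UN_le) simp
    finally have "real (card F) \<le> real (card F0) + (\<Sum>i<J. real (card (S i)))" by (simp flip: of_nat_sum of_nat_add)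
    moreover have "real (card F0) \<le> (3 * \<rho>) powr d * t powr (- \<gamma>)"
    proof -
      have "real (card F0) \<le> (3 * R) ^ CARD('d)"
      proof (rule card_dual_lattice_le[OF inv _ R])
        show "F0 \<subseteq> dual_lattice_of A" using F by (auto simp: F0_def)
        show "\<bar>\<kappa> \<bullet> (A *v axis j 1)\<bar> \<le> R" if "\<kappa> \<in> F0" for \<kappa> j
          using n_ge[of \<kappa> j] that by (simp add: F0_def)
      qed
      also have "\<dots> = (3 * R) powr d" using R by (simp add: d_def powr_realpow)
      also have "\<dots> = (3 * \<rho>) powr d * (t powr (- (\<gamma> / d))) powr d"
        by (simp add: R_def powr_mult mult.assoc)
      also have "\<dots> = (3 * \<rho>) powr d * t powr (- \<gamma>)" using d by (simp add: powr_powr)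
      finally show ?thesis .
    qed
    moreover have "real (card (S i)) \<le> Z * t powr (- \<gamma>) * s ^ i" for i
    proof -
      have "real (card (S i)) \<le> real CARD('d) * (C * (V / (4 * (2 ^ i * R))) powr \<alpha> / t) powr q"
      proof (rule card_shell_le[OF p f_meas f_int C \<alpha> Lip V])
        show "0 < 2 ^ i * R" using R by simp
        have "V < r * \<delta>" by (rule r(2))
        also have "\<dots> \<le> \<delta> * R" using mult_left_mono[OF R_ge, of \<delta>] \<delta> by (simp add: mult.commute)
        also have "\<dots> \<le> \<delta> * (4 * (2 ^ i * R))"
        proof -
          have "1 \<le> 4 * (2::real) ^ i" using one_le_power[of "2::real" i] by linarith
          then have "1 * R \<le> (4 * 2 ^ i) * R" using R by (intro mult_right_mono) auto
          then show ?thesis using \<delta> by (intro mult_left_mono) auto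
        qed
        finally show "V / (4 * (2 ^ i * R)) < \<delta>" using R by (simp add: field_simps)
        show "\<exists>j. 2 ^ i * R \<le> \<bar>\<kappa> \<bullet> (A *v axis j 1)\<bar> \<and> \<bar>\<kappa> \<bullet> (A *v axis j 1)\<bar> \<le> 2 * (2 ^ i * R)"
          if "\<kappa> \<in> S i" for \<kappa>
        proof -
          obtain j where "\<bar>\<kappa> \<bullet> (A *v axis j 1)\<bar> = n \<kappa>" using n_ex by blast
          then show ?thesis using that by (intro exI[of _ j]) (simp add: S_def mult.assoc)
        qed
      qed (use F t large in \<open>auto simp: S_def\<close>)
      \<comment> \<open>Sorting the powers: the shell index contributes
        \<open>2 powr (- (\<alpha> * q))\<close> per step, and the exponents of \<open>t\<close>
        combine by \<open>\<gamma>_eq\<close>.\<close>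
      also have "\<dots> = Z * t powr (- \<gamma>) * s ^ i"
      proof -
        have "(V / (4 * (2 ^ i * R))) powr \<alpha>
            = (V / 4) powr \<alpha> * (\<rho> powr (- \<alpha>) * t powr (\<gamma> / d * \<alpha>)) * 2 powr (- (real i * \<alpha>))"
        proof -
          have "\<rho> powr (- 1) = inverse \<rho>" using \<rho> by (simp add: powr_minus)
          moreover have "2 powr (- real i) = inverse (2 ^ i :: real)" by (simp add: powr_minus powr_realpow)
          moreover have "inverse (t powr (- (\<gamma> / d))) = t powr (\<gamma> / d)" by (simp add: powr_minus)
          ultimately have "V / (4 * (2 ^ i * R)) = (V / 4) * (\<rho> powr (- 1) * t powr (\<gamma> / d)) * 2 powr (- real i)"
            by (simp only: R_def divide_inverse inverse_mult_distrib mult_ac)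
          then show ?thesis by (simp only: powr_mult powr_powr mult_minus_left mult_1_left)
        qed
        then have "C * (V / (4 * (2 ^ i * R))) powr \<alpha> / t
            = (C * (V / 4) powr \<alpha> * \<rho> powr (- \<alpha>)) * (t powr (\<gamma> / d * \<alpha>) * t powr (-1)) * 2 powr (- (real i * \<alpha>))"
          using t by (simp only: powr_minus_divide[of t 1] powr_one divide_inverse mult_1_left mult_ac)
        also have "t powr (\<gamma> / d * \<alpha>) * t powr (-1) = t powr (\<gamma> / d * \<alpha> - 1)"
          by (simp only: powr_add[symmetric] diff_conv_add_uminus)
        finally have "(C * (V / (4 * (2 ^ i * R))) powr \<alpha> / t) powr q
            = (C * (V / 4) powr \<alpha> * \<rho> powr (- \<alpha>)) powr q * t powr ((\<gamma> / d * \<alpha> - 1) * q) * 2 powr (- (real i * \<alpha>) * q)"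
          using C by (simp only: powr_mult powr_powr)
        moreover have "(\<gamma> / d * \<alpha> - 1) * q = - \<gamma>" using \<gamma>_eq by (simp add: algebra_simps)
        moreover have "2 powr (- (real i * \<alpha>) * q) = s ^ i"
          using s powr_realpow[of s i] by (simp add: s_def powr_powr mult_ac)
        ultimately show ?thesis by (simp add: Z_def d_def)
      qed
      finally show ?thesis .
    qed
    then have "(\<Sum>i<J. real (card (S i))) \<le> (\<Sum>i<J. Z * t powr (- \<gamma>) * s ^ i)" by (intro sum_mono)
    moreover have "(\<Sum>i<J. Z * t powr (- \<gamma>) * s ^ i) \<le> Z * t powr (- \<gamma>) * (1 / (1 - s))"
    proof -
      have "(\<Sum>i<J. s ^ i) \<le> 1 / (1 - s)" using s by (simp add: sum_gp_strict divide_right_mono)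
      then show ?thesis using Z by (simp only: sum_distrib_left[symmetric] mult_left_mono mult_nonneg_nonneg powr_ge_zero)
    qed
    ultimately have bounds: "real (card F) \<le> real (card F0) + (\<Sum>i<J. real (card (S i)))"
      "real (card F0) \<le> (3 * \<rho>) powr d * t powr (- \<gamma>)"
      "(\<Sum>i<J. real (card (S i))) \<le> Z * t powr (- \<gamma>) * (1 / (1 - s))"
      by (blast intro: order_trans)+
    show "real (card F) \<le> K * t powr (- \<gamma>)"
    proof -
      have "K * t powr (- \<gamma>) = (3 * \<rho>) powr d * t powr (- \<gamma>) + Z * t powr (- \<gamma>) * (1 / (1 - s))"
        unfolding K_def distrib_right by (simp only: mult_ac)
      then show ?thesis using bounds by linarith
    qed
  qed
qed

section \<open>Boundedness of the coefficients, the Lipschitz condition as an integral bound, and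
  the conclusion\<close>

lemma norm_fourier_coeff_le:
  assumes "integrable \<mu> f"
  shows "norm (fourier_coeff \<Omega> f \<kappa>) \<le> (LINT x|\<mu>. norm (f x))"
proof -
  have "norm (fourier_coeff \<Omega> f \<kappa>) \<le> (LINT x|\<mu>. norm (f x * chi \<kappa> x))"
    using assms by (simp only: fourier_coeff_eq borel_measurable_integrable integral_norm_bound)
  then show ?thesis by (simp add: norm_mult)
qed

text \<open>The big-O condition yields a constant and a ball about 0; raising to the power
  \<open>p\<close> removes the root in \<open>Lp_norm\<close>.\<close>

lemma Lip_space_increment:
  assumes f: "f \<in> Lip_space L \<Omega> \<alpha> p" and p: "p > 0"
  shows "\<exists>C>0. \<exists>\<delta>>0. \<forall>h. norm h < \<delta> \<longrightarrow>
        (LINT x|\<mu>. norm (increment f h x) powr p) \<le> (C * norm h powr \<alpha>) powr p"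
proof -
  have "(\<lambda>h. Lp_norm \<mu> p (increment f h)) \<in> O[nhds 0](\<lambda>h. norm h powr \<alpha>)"
    using f by (simp add: Lip_space_def periodic_ext_eq increment_def[abs_def])
  then obtain C where C: "C > 0"
    "\<forall>\<^sub>F h in nhds 0. norm (Lp_norm \<mu> p (increment f h)) \<le> C * norm (norm h powr \<alpha>)"
    by (elim landau_o.bigE)
  then obtain \<delta> where \<delta>: "\<delta> > 0"
    "\<And>h. dist h 0 < \<delta> \<Longrightarrow> norm (Lp_norm \<mu> p (increment f h)) \<le> C * norm (norm h powr \<alpha>)"
    unfolding eventually_nhds_metric by blast
  show ?thesis
  proof (intro exI conjI allI impI, rule C(1), rule \<delta>(1))
    fix h :: "real^'d" assume "norm h < \<delta>"
    define I where "I = (LINT x|\<mu>. norm (increment f h x) powr p)"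
    have I: "I \<ge> 0" by (simp add: I_def)
    have "I powr (1 / p) \<le> C * norm h powr \<alpha>"
      using \<delta>(2)[of h] \<open>norm h < \<delta>\<close> by (simp add: Lp_norm_def I_def)
    then have "(I powr (1 / p)) powr p \<le> (C * norm h powr \<alpha>) powr p" using p by (intro powr_mono2) auto
    then show "(LINT x|\<mu>. norm (increment f h x) powr p) \<le> (C * norm h powr \<alpha>) powr p"
      using p I by (simp add: powr_powr I_def)
  qed
qed

end

theorem theoremA:
  fixes A :: "real^'d^'d" and \<Omega> :: "(real^'d) set"
    and \<alpha> p :: real and f :: "real^'d \<Rightarrow> complex"
  assumes "invertible A"
    and "fundamental_domain (lattice_of A) \<Omega>"
    and "0 < \<alpha>" and "\<alpha> \<le> 1"
    and "1 < p" and "p \<le> 2"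
    and "f \<in> Lip_space (lattice_of A) \<Omega> \<alpha> p"
  shows "\<forall>\<gamma>::ereal. ereal (p / (p + \<alpha> / real CARD('d) * p - 1)) < \<gamma> \<and> \<gamma> \<le> \<infinity> \<longrightarrow>
           fourier_coeff \<Omega> f \<in> ell_space \<gamma> (dual_lattice_of A)"
proof (intro allI impI)
  fix \<gamma> :: ereal
  define \<gamma>\<^sub>0 where "\<gamma>\<^sub>0 = p / (p + \<alpha> / real CARD('d) * p - 1)"
  assume "ereal (p / (p + \<alpha> / real CARD('d) * p - 1)) < \<gamma> \<and> \<gamma> \<le> \<infinity>"
  then have \<gamma>: "ereal \<gamma>\<^sub>0 < \<gamma>" by (simp add: \<gamma>\<^sub>0_def)
  interpret lattice_tiling A \<Omega> by standard (use assms in auto)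
  have f_meas: "f \<in> borel_measurable \<mu>" and f_int: "integrable \<mu> (\<lambda>x. norm (f x) powr p)"
    using assms(7) by (auto simp: Lip_space_def Lp_space_def)
  have fi: "integrable \<mu> f"
    using integrable_of_integrable_powr[OF finite_measure_\<mu> _ f_meas f_int] assms by simp
  \<comment> \<open>The summand 1 keeps \<open>T\<close> positive even if \<open>f\<close> vanishes
    almost everywhere. The bound by \<open>T\<close> settles the case of infinite \<gamma> and caps
    the levels in the finite case.\<close>
  define T where "T = 1 + (LINT x|\<mu>. norm (f x))"
  have "0 \<le> (LINT x|\<mu>. norm (f x))" by simp
  then have T: "T > 0" "norm (fourier_coeff \<Omega> f \<kappa>) \<le> T" for \<kappa>
    using norm_fourier_coeff_le[OF fi, of \<kappa>] unfolding T_def by linarith+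
  show "fourier_coeff \<Omega> f \<in> ell_space \<gamma> (dual_lattice_of A)"
  proof (cases \<gamma>)
    case PInf
    then show ?thesis using T(2) by (auto simp: ell_space_def bounded_iff)
  next
    case MInf
    then show ?thesis using \<gamma> by simp
  next
    case (real g)
    define q where "q = p / (p - 1)"
    have q: "1 / p + 1 / q = 1" "q > 0" using assms by (auto simp: q_def field_simps)
    define D where "D = p - 1 + \<alpha> / real CARD('d) * p"
    have D: "D > 0"
      unfolding D_def using assms by (intro add_pos_pos mult_pos_pos divide_pos_pos) auto
    have \<gamma>\<^sub>0_D: "\<gamma>\<^sub>0 = p / D" by (simp add: \<gamma>\<^sub>0_def D_def algebra_simps)
    then have "\<gamma>\<^sub>0 > 0" using D assms by simp
    \<comment> \<open>This identifies the stated critical exponent with the one found by balancing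
      in terms of the conjugate exponent \<open>q\<close>.\<close>
    have "1 + \<alpha> * q / real CARD('d) = D / (p - 1)"
      using assms by (simp add: q_def D_def field_simps)
    then have \<gamma>\<^sub>0: "\<gamma>\<^sub>0 = q / (1 + \<alpha> * q / real CARD('d))"
      using assms by (simp add: \<gamma>\<^sub>0_D q_def)
    obtain C \<delta> where C: "C > 0" "\<delta> > 0" "\<And>h. norm h < \<delta> \<Longrightarrow>
        (LINT x|\<mu>. norm (increment f h x) powr p) \<le> (C * norm h powr \<alpha>) powr p"
      using Lip_space_increment[OF assms(7) less_trans[OF zero_less_one assms(5)]] by blast
    obtain K where K: "K \<ge> 0"
      "\<forall>t F. 0 < t \<longrightarrow> t \<le> T \<longrightarrow> finite F \<longrightarrow> F \<subseteq> dual_lattice_of A \<longrightarrow>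
         (\<forall>\<kappa>\<in>F. t \<le> norm (fourier_coeff \<Omega> f \<kappa>)) \<longrightarrow> real (card F) \<le> K * t powr (- \<gamma>\<^sub>0)"
      using card_large_coeffs_le[OF assms(5,6) q(1) f_meas f_int C(1) assms(3) C(2) T(1) C(3) \<gamma>\<^sub>0] by blast
    have "(\<lambda>\<kappa>. norm (fourier_coeff \<Omega> f \<kappa>) powr g) summable_on dual_lattice_of A"
    proof (rule summable_on_powr_of_weak_bound[OF _ _ T(1) K(1)])
      show "\<gamma>\<^sub>0 < g" "0 < g" using \<gamma> real \<open>\<gamma>\<^sub>0 > 0\<close> by auto
    qed (use T K(2) in auto)
    then show ?thesis by (simp add: ell_space_def real)
  qed
qed

end
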